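(* Let $p$ be a prime and let $G$ be a finitely generated pro-$p$ group with at most two defining relations. Suppose that the $\mathbb{F}_p$-cohomology algebra $H^\bullet(G,\mathbb{F}_p)=\bigoplus_{n\ge 0}H^n(G,\mathbb{F}_p)$, endowed with the cup product, is quadratic, and, if $p=2$, suppose moreover that $a^2=0$ for every $a\in H^1(G,\mathbb{F}_2)$. Then $H^\bullet(G,\mathbb{F}_p)$ is universally Koszul.
   Context: Cohomology of a pro-$p$ group is continuous cohomology with coefficients in the trivial module $\mathbb{F}_p$. Defining relations: a minimal presentation of a finitely generated pro-$p$ group $G$ is an isomorphism $G\simeq F/R$ with $F$ a free pro-$p$ group and $R$ a closed normal subgroup of $F$ contained in the Frattini subgroup $F^p[F,F]$. $G$ has $m$ defining relations if, for a minimal presentation, $m$ is the minimal number of generators of $R$ as a closed normal subgroup of $F$ (equivalently, $m=\dim_{\mathbb{F}_p} H^2(G,\mathbb{F}_p)$). Graded algebras $A_\bullet=\bigoplus_{n\ge0}A_n$ are unital associative $\mathbb{F}_p$-algebras with $A_0=\mathbb{F}_p$ and $\dim A_n<\infty$ for all $n\geq 1$; all ideals are graded, and for an ideal $I$ we write $I_n=I\cap A_n$. The algebra $A_\bullet$ is quadratic if $A_\bullet\simeq T_\bullet(A_1)/(\Omega)$ as graded algebras, where $T_\bullet(A_1)$ is the tensor algebra and $(\Omega)$ is the two-sided ideal generated by some subset $\Omega\subseteq A_1\otimes A_1$. For ideals $I,J$ of $A_\bullet$, the colon ideal is $I:J=\{a\in A_\bullet\mid a\cdot J\subseteq I\}$.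 For a quadratic algebra $A_\bullet$, let $\mathcal{L}(A_\bullet)$ be the set of all ideals $I$ of $A_\bullet$ generated by a subset of $A_1$, i.e. with $I=A_\bullet\cdot I_1$ (including $I=(0)$). A quadratic algebra $A_\bullet$ is universally Koszul if for every $I\in\mathcal{L}(A_\bullet)$ and every $b\in A_1\smallsetminus I_1$ one has $I:(b)\in\mathcal{L}(A_\bullet)$, where $(b)$ is the two-sided ideal generated by $b$. *)

theory Defs
  imports
    "HOL-Analysis.Abstract_Topological_Spaces"
    "HOL-Analysis.Function_Topology"
    "HOL-Algebra.QuotRing"
    "HOL-Algebra.Ideal_Product"
    "HOL-Number_Theory.Residues"
begin

section \<open>Pro-\<open>p\<close> groups\<close>

locale topological_group = group G for G (structure) +
  fixes T :: "'a topology"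
  assumes topspace_eq: "topspace T = carrier G"
    and continuous_mult: "continuous_map (prod_topology T T) T (\<lambda>(x, y). x \<otimes> y)"
    and continuous_inv: "continuous_map T T (\<lambda>x. inv x)"

text \<open>An infinite index cannot slip through below: \<^const>\<open>card\<close> of an infinite set is \<open>0\<close>,
  which is not a power of a prime.\<close>

locale pro_p_group = topological_group G T for p :: nat and G (structure) and T +
  assumes compact: "compact_space T"
    and Hausdorff: "Hausdorff_space T"
    and totally_disconnected: "connectedin T S \<Longrightarrow> \<exists>x. S \<subseteq> {x}"
    and index_p_power: "N \<lhd> G \<Longrightarrow> openin T N \<Longrightarrow> \<exists>k. card (rcosets N) = p ^ k"

definition topologically_finitely_generated ::
    "('a, 'm) monoid_scheme \<Rightarrow> 'a topology \<Rightarrow> bool" where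
  "topologically_finitely_generated G T \<longleftrightarrow>
     (\<exists>S. S \<subseteq> carrier G \<and> finite S \<and> T closure_of generate G S = carrier G)"

text \<open>As usual for pro-\<open>p\<close> groups, \<open>F\<^sup>p[F,F]\<close> denotes the \<^emph>\<open>closed\<close> subgroup
  generated by \<open>p\<close>-th powers and commutators.\<close>

definition frattini :: "nat \<Rightarrow> ('a, 'm) monoid_scheme \<Rightarrow> 'a topology \<Rightarrow> 'a set" where
  "frattini p F T = T closure_of
     generate F ((\<lambda>x. x [^]\<^bsub>F\<^esub> p) ` carrier F \<union> derived_set F (carrier F))"

definition converges_to_one ::
    "('a, 'm) monoid_scheme \<Rightarrow> 'a topology \<Rightarrow> 'x set \<Rightarrow> ('x \<Rightarrow> 'a) \<Rightarrow> bool" where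
  "converges_to_one G T X f \<longleftrightarrow>
     (\<forall>U. openin T U \<and> \<one>\<^bsub>G\<^esub> \<in> U \<longrightarrow> finite {x \<in> X. f x \<notin> U})"

text \<open>The free pro-\<open>p\<close> group on a basis \<open>X\<close> converging to \<open>1\<close>, by its universal property.
  Quantification over types being impossible, the target groups live on the type \<^typ>\<open>nat set\<close>.
  This is no restriction: every finite \<open>p\<close>-group has a copy there, and the universal property for
  finite \<open>p\<close>-groups implies the one for all pro-\<open>p\<close> groups by passage to the inverse limit.\<close>

definition free_pro_p :: "nat \<Rightarrow> ('a, 'm) monoid_scheme \<Rightarrow> 'a topology \<Rightarrow> 'a set \<Rightarrow> bool" where
  "free_pro_p p F T X \<longleftrightarrow>
     pro_p_group p F T \<and> X \<subseteq> carrier F \<and> converges_to_one F T X (\<lambda>x. x) \<and>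
     (\<forall>(H :: nat set monoid) TH g.
        pro_p_group p H TH \<and> g \<in> X \<rightarrow> carrier H \<and> converges_to_one H TH X g \<longrightarrow>
        (\<exists>h. h \<in> hom F H \<and> continuous_map T TH h \<and> (\<forall>x\<in>X. h x = g x) \<and>
             (\<forall>h'. h' \<in> hom F H \<and> continuous_map T TH h' \<and> (\<forall>x\<in>X. h' x = g x) \<longrightarrow>
                   (\<forall>y\<in>carrier F. h' y = h y))))"

text \<open>\<open>TQ\<close> is the quotient topology on \<open>F/R\<close>, and \<open>\<phi>\<close> an isomorphism \<open>F/R \<simeq> G\<close> of
  topological groups.\<close>

definition minimal_presentation ::
    "nat \<Rightarrow> ('f, 'n) monoid_scheme \<Rightarrow> 'f topology \<Rightarrow> 'f set \<Rightarrow>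
     ('a, 'm) monoid_scheme \<Rightarrow> 'a topology \<Rightarrow> bool" where
  "minimal_presentation p F TF R G T \<longleftrightarrow>
     (\<exists>X. free_pro_p p F TF X) \<and> R \<lhd> F \<and> closedin TF R \<and> R \<subseteq> frattini p F TF \<and>
     (\<exists>TQ \<phi>. quotient_map TF TQ (\<lambda>x. R #>\<^bsub>F\<^esub> x) \<and>
             \<phi> \<in> iso (F Mod R) G \<and> homeomorphic_map TQ T \<phi>)"

definition closed_normal_closure ::
    "('a, 'm) monoid_scheme \<Rightarrow> 'a topology \<Rightarrow> 'a set \<Rightarrow> 'a set" where
  "closed_normal_closure F T S = \<Inter>{N. N \<lhd> F \<and> closedin T N \<and> S \<subseteq> N}"

definition minimal_number_of_normal_generators ::
    "('a, 'm) monoid_scheme \<Rightarrow> 'a topology \<Rightarrow> 'a set \<Rightarrow> nat \<Rightarrow> bool" where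
  "minimal_number_of_normal_generators F T R m \<longleftrightarrow>
     (\<exists>S. S \<subseteq> R \<and> finite S \<and> card S = m \<and> closed_normal_closure F T S = R) \<and>
     (\<forall>S. S \<subseteq> R \<and> finite S \<and> closed_normal_closure F T S = R \<longrightarrow> m \<le> card S)"


section \<open>Graded algebras\<close>

record ('k, 'a) galg = "('k, 'a) module" +
  component :: "nat \<Rightarrow> 'a set"

definition graded_algebra ::
    "('k, 'n) ring_scheme \<Rightarrow> ('k, 'a, 'm) galg_scheme \<Rightarrow> bool" where
  "graded_algebra K A \<longleftrightarrow>
     field K \<and> ring A \<and> Module.module K A \<and>
     (\<forall>c\<in>carrier K. \<forall>x\<in>carrier A. \<forall>y\<in>carrier A.
        (c \<odot>\<^bsub>A\<^esub> x) \<otimes>\<^bsub>A\<^esub> y = c \<odot>\<^bsub>A\<^esub> (x \<otimes>\<^bsub>A\<^esub> y) \<and>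
        x \<otimes>\<^bsub>A\<^esub> (c \<odot>\<^bsub>A\<^esub> y) = c \<odot>\<^bsub>A\<^esub> (x \<otimes>\<^bsub>A\<^esub> y)) \<and>
     (\<forall>n. submodule (component A n) K A) \<and>
     (\<forall>x\<in>carrier A. \<exists>!c. (\<forall>n. c n \<in> component A n) \<and> finite {n. c n \<noteq> \<zero>\<^bsub>A\<^esub>} \<and>
        x = (\<Oplus>\<^bsub>A\<^esub>n\<in>{n. c n \<noteq> \<zero>\<^bsub>A\<^esub>}. c n)) \<and>
     (\<forall>m n. \<forall>x\<in>component A m. \<forall>y\<in>component A n. x \<otimes>\<^bsub>A\<^esub> y \<in> component A (m + n)) \<and>
     bij_betw (\<lambda>c. c \<odot>\<^bsub>A\<^esub> \<one>\<^bsub>A\<^esub>) (carrier K) (component A 0) \<and>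
     (\<forall>n\<ge>1. \<exists>B. finite B \<and> B \<subseteq> component A n \<and>
        (\<forall>x\<in>component A n. \<exists>c\<in>B \<rightarrow> carrier K. x = (\<Oplus>\<^bsub>A\<^esub>b\<in>B. c b \<odot>\<^bsub>A\<^esub> b)))"

definition graded_iso ::
    "('k, 'n) ring_scheme \<Rightarrow> ('k, 'a, 'm) galg_scheme \<Rightarrow> ('k, 'b, 'l) galg_scheme \<Rightarrow> ('a \<Rightarrow> 'b) set"
  where
  "graded_iso K A B = {\<phi> \<in> ring_iso A B.
     (\<forall>c\<in>carrier K. \<forall>x\<in>carrier A. \<phi> (c \<odot>\<^bsub>A\<^esub> x) = c \<odot>\<^bsub>B\<^esub> \<phi> x) \<and>
     (\<forall>n. \<phi> ` component A n = component B n)}"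

text \<open>The quotient by a two-sided (graded) ideal: the library's quotient ring with the induced
  scalar multiplication and grading.\<close>

definition quotient_algebra :: "('k, 'a, 'm) galg_scheme \<Rightarrow> 'a set \<Rightarrow> ('k, 'a set) galg" where
  "quotient_algebra A I =
    \<lparr>carrier = carrier (A Quot I),
     monoid.mult = monoid.mult (A Quot I),
     one = one (A Quot I),
     zero = zero (A Quot I),
     add = add (A Quot I),
     smult = (\<lambda>c X. \<Union>x\<in>X. I +>\<^bsub>A\<^esub> (c \<odot>\<^bsub>A\<^esub> x)),
     component = (\<lambda>n. (\<lambda>x. I +>\<^bsub>A\<^esub> x) ` component A n)\<rparr>"


subsection \<open>Tensor algebras and quadratic algebras\<close>

text \<open>The free associative unital algebra on the set \<open>V\<close>: finitely supported functions on words
  over \<open>V\<close> with the concatenation product.\<close>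

definition free_algebra_carrier :: "('k, 'n) ring_scheme \<Rightarrow> 'v set \<Rightarrow> ('v list \<Rightarrow> 'k) set" where
  "free_algebra_carrier K V =
    {f. range f \<subseteq> carrier K \<and> finite {w. f w \<noteq> \<zero>\<^bsub>K\<^esub>} \<and> (\<forall>w. f w \<noteq> \<zero>\<^bsub>K\<^esub> \<longrightarrow> set w \<subseteq> V)}"

definition free_algebra :: "('k, 'n) ring_scheme \<Rightarrow> 'v set \<Rightarrow> ('k, 'v list \<Rightarrow> 'k) galg" where
  "free_algebra K V =
    \<lparr>carrier = free_algebra_carrier K V,
     monoid.mult = (\<lambda>f g w. \<Oplus>\<^bsub>K\<^esub>i\<in>{..length w}. f (take i w) \<otimes>\<^bsub>K\<^esub> g (drop i w)),
     one = (\<lambda>w. if w = [] then \<one>\<^bsub>K\<^esub> else \<zero>\<^bsub>K\<^esub>),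
     zero = (\<lambda>w. \<zero>\<^bsub>K\<^esub>),
     add = (\<lambda>f g w. f w \<oplus>\<^bsub>K\<^esub> g w),
     smult = (\<lambda>c f w. c \<otimes>\<^bsub>K\<^esub> f w),
     component = (\<lambda>n. {f \<in> free_algebra_carrier K V. \<forall>w. f w \<noteq> \<zero>\<^bsub>K\<^esub> \<longrightarrow> length w = n})\<rparr>"

definition letter :: "('k, 'n) ring_scheme \<Rightarrow> 'v \<Rightarrow> 'v list \<Rightarrow> 'k" where
  "letter K v = (\<lambda>w. if w = [v] then \<one>\<^bsub>K\<^esub> else \<zero>\<^bsub>K\<^esub>)"

text \<open>The tensor algebra of the \<open>K\<close>-module \<open>M\<close> is the free algebra on the underlying set of \<open>M\<close>
  modulo the relations making \<^const>\<open>letter\<close> linear; its component of degree \<open>n\<close> is the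
  \<open>n\<close>-th tensor power of \<open>M\<close>. Ring multiplication and unit of the record \<open>M\<close> are irrelevant.\<close>

definition linearity_relations ::
    "('k, 'n) ring_scheme \<Rightarrow> ('k, 'v, 'm) module_scheme \<Rightarrow> ('v list \<Rightarrow> 'k) set" where
  "linearity_relations K M = (let FA = free_algebra K (carrier M) in
     {letter K (v \<oplus>\<^bsub>M\<^esub> w) \<ominus>\<^bsub>FA\<^esub> (letter K v \<oplus>\<^bsub>FA\<^esub> letter K w) | v w.
        v \<in> carrier M \<and> w \<in> carrier M} \<union>
     {letter K (c \<odot>\<^bsub>M\<^esub> v) \<ominus>\<^bsub>FA\<^esub> (c \<odot>\<^bsub>FA\<^esub> letter K v) | c v.
        c \<in> carrier K \<and> v \<in> carrier M})"

definition tensor_algebra ::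
    "('k, 'n) ring_scheme \<Rightarrow> ('k, 'v, 'm) module_scheme \<Rightarrow> ('k, ('v list \<Rightarrow> 'k) set) galg" where
  "tensor_algebra K M =
     quotient_algebra (free_algebra K (carrier M))
       (Idl\<^bsub>free_algebra K (carrier M)\<^esub> (linearity_relations K M))"

definition quadratic_algebra ::
    "('k, 'n) ring_scheme \<Rightarrow> ('k, 'a, 'm) galg_scheme \<Rightarrow> bool" where
  "quadratic_algebra K A \<longleftrightarrow> graded_algebra K A \<and>
     (let TA = tensor_algebra K (A\<lparr>carrier := component A 1\<rparr>) in
      \<exists>\<Omega>. \<Omega> \<subseteq> component TA 2 \<and> graded_iso K A (quotient_algebra TA (Idl\<^bsub>TA\<^esub> \<Omega>)) \<noteq> {})"


subsection \<open>Universally Koszul algebras\<close>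

definition graded_ideal :: "('k, 'a, 'm) galg_scheme \<Rightarrow> 'a set \<Rightarrow> bool" where
  "graded_ideal A I \<longleftrightarrow> ideal I A \<and>
     (\<forall>c. (\<forall>n. c n \<in> component A n) \<and> finite {n. c n \<noteq> \<zero>\<^bsub>A\<^esub>} \<and>
        (\<Oplus>\<^bsub>A\<^esub>n\<in>{n. c n \<noteq> \<zero>\<^bsub>A\<^esub>}. c n) \<in> I \<longrightarrow> (\<forall>n. c n \<in> I))"

definition colon_ideal :: "('k, 'a, 'm) galg_scheme \<Rightarrow> 'a set \<Rightarrow> 'a set \<Rightarrow> 'a set" where
  "colon_ideal A I J = {a \<in> carrier A. \<forall>x\<in>J. a \<otimes>\<^bsub>A\<^esub> x \<in> I}"

text \<open>\<^const>\<open>ideal_prod\<close> forms all finite sums of products, so the equation below says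
  \<open>I = A \<cdot> I\<^sub>1\<close>.\<close>

definition linear_ideals :: "('k, 'a, 'm) galg_scheme \<Rightarrow> 'a set set" where
  "linear_ideals A = {I. graded_ideal A I \<and> I = carrier A \<cdot>\<^bsub>A\<^esub> (I \<inter> component A 1)}"

definition universally_koszul ::
    "('k, 'n) ring_scheme \<Rightarrow> ('k, 'a, 'm) galg_scheme \<Rightarrow> bool" where
  "universally_koszul K A \<longleftrightarrow> quadratic_algebra K A \<and>
     (\<forall>I\<in>linear_ideals A. \<forall>b\<in>component A 1 - I.
        colon_ideal A I (Idl\<^bsub>A\<^esub> {b}) \<in> linear_ideals A)"


section \<open>Continuous cohomology with trivial coefficients\<close>

text \<open>An \<open>n\<close>-tuple of elements of \<open>G\<close> is a function on \<open>{..<n}\<close>, made \<^const>\<open>undefined\<close>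
  elsewhere as in the carrier of the product topology.\<close>

abbreviation tuples :: "('g, 'm) monoid_scheme \<Rightarrow> nat \<Rightarrow> (nat \<Rightarrow> 'g) set" where
  "tuples G n \<equiv> {..<n} \<rightarrow>\<^sub>E carrier G"

type_synonym ('g, 'k) cochain = "(nat \<Rightarrow> 'g) \<Rightarrow> 'k"

text \<open>Inhomogeneous continuous cochains with values in the ring \<open>K\<close>, which carries the discrete
  topology and the trivial action of \<open>G\<close>.\<close>

definition cochains ::
    "('k, 'n) ring_scheme \<Rightarrow> ('g, 'm) monoid_scheme \<Rightarrow> 'g topology \<Rightarrow> nat \<Rightarrow> ('g, 'k) cochain set"
  where
  "cochains K G T n = {f \<in> extensional (tuples G n).
     continuous_map (product_topology (\<lambda>_. T) {..<n}) (discrete_topology (carrier K)) f}"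

definition zero_cochain ::
    "('k, 'n) ring_scheme \<Rightarrow> ('g, 'm) monoid_scheme \<Rightarrow> nat \<Rightarrow> ('g, 'k) cochain" where
  "zero_cochain K G n = (\<lambda>g\<in>tuples G n. \<zero>\<^bsub>K\<^esub>)"

text \<open>The faces of an \<open>(n+1)\<close>-tuple: for \<open>0 < j \<le> n\<close> the \<open>j\<close>-th face multiplies the \<open>j\<close>-th and
  \<open>(j+1)\<close>-st entries, for \<open>j = 0\<close> and \<open>j = n+1\<close> it drops the first, respectively last, entry.\<close>

definition face :: "('g, 'm) monoid_scheme \<Rightarrow> nat \<Rightarrow> nat \<Rightarrow> (nat \<Rightarrow> 'g) \<Rightarrow> nat \<Rightarrow> 'g" where
  "face G n j g = (\<lambda>i\<in>{..<n}. if i + 1 < j then g i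
                             else if i + 1 = j then g i \<otimes>\<^bsub>G\<^esub> g (i + 1)
                             else g (i + 1))"

definition coboundary ::
    "('k, 'n) ring_scheme \<Rightarrow> ('g, 'm) monoid_scheme \<Rightarrow> nat \<Rightarrow> ('g, 'k) cochain \<Rightarrow> ('g, 'k) cochain"
  where
  "coboundary K G n f = (\<lambda>g\<in>tuples G (Suc n).
     \<Oplus>\<^bsub>K\<^esub>j\<in>{..Suc n}. ((\<ominus>\<^bsub>K\<^esub> \<one>\<^bsub>K\<^esub>) [^]\<^bsub>K\<^esub> j) \<otimes>\<^bsub>K\<^esub> f (face G n j g))"

definition cup ::
    "('k, 'n) ring_scheme \<Rightarrow> ('g, 'm) monoid_scheme \<Rightarrow> nat \<Rightarrow> nat \<Rightarrow>
     ('g, 'k) cochain \<Rightarrow> ('g, 'k) cochain \<Rightarrow> ('g, 'k) cochain" where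
  "cup K G m n f h = (\<lambda>g\<in>tuples G (m + n).
     f (\<lambda>i\<in>{..<m}. g i) \<otimes>\<^bsub>K\<^esub> h (\<lambda>i\<in>{..<n}. g (m + i)))"

text \<open>The direct sum of all cochain groups, consisting of finitely supported sequences, is an
  algebra under the cup product.\<close>

definition total_cochains ::
    "('k, 'n) ring_scheme \<Rightarrow> ('g, 'm) monoid_scheme \<Rightarrow> 'g topology \<Rightarrow> (nat \<Rightarrow> ('g, 'k) cochain) set"
  where
  "total_cochains K G T =
    {a. (\<forall>n. a n \<in> cochains K G T n) \<and> finite {n. a n \<noteq> zero_cochain K G n}}"

definition cochain_algebra ::
    "('k, 'n) ring_scheme \<Rightarrow> ('g, 'm) monoid_scheme \<Rightarrow> 'g topology \<Rightarrow>
     ('k, nat \<Rightarrow> ('g, 'k) cochain) galg" where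
  "cochain_algebra K G T =
    \<lparr>carrier = total_cochains K G T,
     monoid.mult = (\<lambda>a b n. \<lambda>g\<in>tuples G n. \<Oplus>\<^bsub>K\<^esub>i\<in>{..n}. cup K G i (n - i) (a i) (b (n - i)) g),
     one = (\<lambda>n. \<lambda>g\<in>tuples G n. if n = 0 then \<one>\<^bsub>K\<^esub> else \<zero>\<^bsub>K\<^esub>),
     zero = zero_cochain K G,
     add = (\<lambda>a b n. \<lambda>g\<in>tuples G n. a n g \<oplus>\<^bsub>K\<^esub> b n g),
     smult = (\<lambda>c a n. \<lambda>g\<in>tuples G n. c \<otimes>\<^bsub>K\<^esub> a n g),
     component = (\<lambda>n. {a \<in> total_cochains K G T. \<forall>m. m \<noteq> n \<longrightarrow> a m = zero_cochain K G m})\<rparr>"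

definition differential ::
    "('k, 'n) ring_scheme \<Rightarrow> ('g, 'm) monoid_scheme \<Rightarrow>
     (nat \<Rightarrow> ('g, 'k) cochain) \<Rightarrow> nat \<Rightarrow> ('g, 'k) cochain" where
  "differential K G a n =
     (case n of 0 \<Rightarrow> zero_cochain K G 0 | Suc m \<Rightarrow> coboundary K G m (a m))"

definition cocycles ::
    "('k, 'n) ring_scheme \<Rightarrow> ('g, 'm) monoid_scheme \<Rightarrow> 'g topology \<Rightarrow> (nat \<Rightarrow> ('g, 'k) cochain) set"
  where
  "cocycles K G T = {a \<in> total_cochains K G T. differential K G a = zero_cochain K G}"

definition cocycle_algebra ::
    "('k, 'n) ring_scheme \<Rightarrow> ('g, 'm) monoid_scheme \<Rightarrow> 'g topology \<Rightarrow>
     ('k, nat \<Rightarrow> ('g, 'k) cochain) galg" where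
  "cocycle_algebra K G T = (cochain_algebra K G T)
     \<lparr>carrier := cocycles K G T,
      component := (\<lambda>n. component (cochain_algebra K G T) n \<inter> cocycles K G T)\<rparr>"

text \<open>The cocycles form a subalgebra by the Leibniz rule, and the coboundaries an ideal in it. The
  component of degree \<open>n\<close> of the quotient is \<open>H\<^sup>n(G,K) = Z\<^sup>n/B\<^sup>n\<close>, and the product is the cup
  product.\<close>

definition cohomology_algebra ::
    "('k, 'n) ring_scheme \<Rightarrow> ('g, 'm) monoid_scheme \<Rightarrow> 'g topology \<Rightarrow>
     ('k, (nat \<Rightarrow> ('g, 'k) cochain) set) galg" where
  "cohomology_algebra K G T =
     quotient_algebra (cocycle_algebra K G T) (differential K G ` total_cochains K G T)"

end

theory Submission
  imports Defs "HOL-Library.Countable"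
begin

text \<open>Write \<open>A\<close> for the cohomology algebra and \<open>V = A\<^sub>1\<close>. Squares of elements of \<open>V\<close> vanish, being
  coboundaries if \<open>p\<close> is odd and by hypothesis if \<open>p = 2\<close>; and \<open>A\<close> is generated by \<open>V\<close>, being
  quadratic. The dimension of \<open>A\<^sub>2\<close> is at most the number of relations: a cup product of
  characters becomes a coboundary \<open>\<delta>u\<close> on the free group, because the characters lift to a
  homomorphism to the unitriangular group, and if \<open>u\<close> vanishes on normal generators of \<open>R\<close> it
  descends to \<open>F/R\<close>. Hence any three elements of \<open>A\<^sub>2\<close> are linearly dependent. Multiplying a relation
  between \<open>xy\<close>, \<open>xz\<close>, \<open>yz\<close> by \<open>x\<close>, \<open>y\<close> or \<open>z\<close> shows \<open>xyz = 0\<close>, so \<open>A\<^sub>3 = 0\<close>, and the colon ideal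
  \<open>I : (b)\<close> is \<open>U + A\<^sub>2\<close> with \<open>U = {a \<in> V. ab \<in> I}\<close>. It is generated by \<open>U\<close> since \<open>A\<^sub>2 = V U\<close>.\<close>

section \<open>Algebras with vanishing squares and at most two-dimensional degree two\<close>

text \<open>Since degree 2 is spanned by cup products of characters, it is enough to split these on
  the free group. A splitting function \<open>u\<close> has one value at each normal generator of
  \<open>R\<close>, so every class in degree 2 yields a vector with at most two entries, and three
  such vectors are always dependent. Dimension is used only in this form, which is why
  \<open>dependent\<close> speaks of three elements and not of a basis. The universal property of
  the free group fixes the type \<open>nat set\<close> for its targets; hence the scalars are taken
  from a countable type and the unitriangular group is encoded by sets of numbers. The parity of
  \<open>p\<close> matters only for the vanishing of squares. Polarization then gives
  anticommutativity in every characteristic, and what remains is linear algebra of an alternating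
  product with values in a space of dimension at most two. The critical point there is that the
  annihilator \<open>U\<close> of \<open>b\<close> modulo \<open>I\<close> may be a small part of
  degree 1 and must still generate all of degree 2.\<close>

locale short_algebra =
  fixes K :: "('k, 'n) ring_scheme" and A :: "('k, 'a, 'm) galg_scheme" (structure)
  assumes graded: "graded_algebra K A"
    and generated: "1 \<le> n \<Longrightarrow> component A (Suc n) \<subseteq> component A 1 \<cdot> component A n"
    and square_zero: "a \<in> component A 1 \<Longrightarrow> a \<otimes> a = \<zero>"
    and dependent: "\<lbrakk>x \<in> component A 2; y \<in> component A 2; z \<in> component A 2\<rbrakk> \<Longrightarrow>
      \<exists>\<alpha>\<in>carrier K. \<exists>\<beta>\<in>carrier K. \<exists>\<gamma>\<in>carrier K. (\<alpha> \<noteq> \<zero>\<^bsub>K\<^esub> \<or> \<beta> \<noteq> \<zero>\<^bsub>K\<^esub> \<or> \<gamma> \<noteq> \<zero>\<^bsub>K\<^esub>) \<and>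
        \<alpha> \<odot> x \<oplus> \<beta> \<odot> y \<oplus> \<gamma> \<odot> z = \<zero>"
begin

sublocale K: field K
  using graded by (simp add: graded_algebra_def)

sublocale ring A
  using graded by (simp add: graded_algebra_def)

sublocale module K A
  using graded by (simp add: graded_algebra_def)

lemma smult_mult:
  assumes "c \<in> carrier K" "x \<in> carrier A" "y \<in> carrier A"
  shows "(c \<odot> x) \<otimes> y = c \<odot> (x \<otimes> y)" "x \<otimes> (c \<odot> y) = c \<odot> (x \<otimes> y)"
  using graded assms unfolding graded_algebra_def by blast+

lemma component_submodule: "submodule (component A n) K A"
  using graded unfolding graded_algebra_def by blast

lemma component_carrier [simp]: "x \<in> component A n \<Longrightarrow> x \<in> carrier A"
  using submoduleE(1)[OF component_submodule] by blast

lemma component_zero [simp]: "\<zero> \<in> component A n"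
  using submodule.axioms(1)[OF component_submodule, of n] subgroup.one_closed by fastforce

lemma component_add [simp]:
  "\<lbrakk>x \<in> component A n; y \<in> component A n\<rbrakk> \<Longrightarrow> x \<oplus> y \<in> component A n"
  using submoduleE(5)[OF component_submodule] by blast

lemma component_smult [simp]:
  "\<lbrakk>c \<in> carrier K; x \<in> component A n\<rbrakk> \<Longrightarrow> c \<odot> x \<in> component A n"
  using submoduleE(4)[OF component_submodule] by blast

lemma component_uminus [simp]: "x \<in> component A n \<Longrightarrow> \<ominus> x \<in> component A n"
  using submoduleE(3)[OF component_submodule] by blast

lemma component_mult:
  "\<lbrakk>x \<in> component A m; y \<in> component A n; k = m + n\<rbrakk> \<Longrightarrow> x \<otimes> y \<in> component A k"
  using graded unfolding graded_algebra_def by blast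

lemma component_0E:
  assumes "x \<in> component A 0"
  obtains c where "c \<in> carrier K" "x = c \<odot> \<one>"
proof -
  have "bij_betw (\<lambda>c. c \<odot> \<one>) (carrier K) (component A 0)"
    using graded unfolding graded_algebra_def by blast
  thus thesis
    using assms that by (auto simp: bij_betw_def)
qed

section \<open>Cancelling scalars, and the vanishing of triple products\<close>

lemma smult_solve:
  assumes "\<alpha> \<in> carrier K" "\<alpha> \<noteq> \<zero>\<^bsub>K\<^esub>" "x \<in> carrier A" "w \<in> carrier A" "\<alpha> \<odot> x \<oplus> w = \<zero>"
  shows "x = (\<ominus>\<^bsub>K\<^esub> (inv\<^bsub>K\<^esub> \<alpha>)) \<odot> w"
proof -
  have i: "(inv\<^bsub>K\<^esub> \<alpha>) \<in> carrier K" "(inv\<^bsub>K\<^esub> \<alpha>) \<otimes>\<^bsub>K\<^esub> \<alpha> = \<one>\<^bsub>K\<^esub>"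
    using assms K.field_Units by (auto intro: K.Units_l_inv)
  have "\<alpha> \<odot> x = \<ominus> w"
    using assms by (simp add: minus_equality[symmetric])
  hence "x = (inv\<^bsub>K\<^esub> \<alpha>) \<odot> (\<ominus> w)"
    using smult_assoc1[OF i(1) assms(1,3)] assms i(2) by simp
  thus ?thesis
    using i assms by (simp add: smult_l_minus smult_r_minus)
qed

lemma smult_eq_zero:
  assumes "\<alpha> \<in> carrier K" "\<alpha> \<noteq> \<zero>\<^bsub>K\<^esub>" "x \<in> carrier A" "\<alpha> \<odot> x = \<zero>"
  shows "x = \<zero>"
  using smult_solve[of \<alpha> x "\<zero>"] assms smult_r_null K.field_Units by simp

text \<open>Polarization: expand the vanishing square of \<open>a \<oplus> b\<close>. This covers
  characteristic 2, where the sign has no effect.\<close>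

lemma anticommute:
  assumes "a \<in> component A 1" "b \<in> component A 1"
  shows "b \<otimes> a = \<ominus> (a \<otimes> b)"
proof -
  have "(a \<oplus> b) \<otimes> (a \<oplus> b) = \<zero>"
    using assms by (intro square_zero) simp
  hence "b \<otimes> a \<oplus> a \<otimes> b = \<zero>"
    using assms square_zero by (simp add: l_distr r_distr)
  thus ?thesis
    using assms by (simp add: minus_equality)
qed

text \<open>Each of the products \<open>x \<otimes> y\<close>, \<open>x \<otimes> z\<close>,
  \<open>y \<otimes> z\<close> omits one of the three factors. Multiplying the relation by the
  factor omitted from a term with nonzero coefficient makes a square appear in the other two terms,
  so only that term survives.\<close>

lemma triple_product:
  assumes "x \<in> component A 1" "y \<in> component A 1" "z \<in> component A 1"
  shows "x \<otimes> (y \<otimes> z) = \<zero>"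
proof -
  have c: "x \<in> carrier A" "y \<in> carrier A" "z \<in> carrier A"
    using assms by auto
  have 2: "x \<otimes> y \<in> component A 2" "x \<otimes> z \<in> component A 2" "y \<otimes> z \<in> component A 2"
    using assms by (auto intro: component_mult)
  obtain \<alpha> \<beta> \<gamma> where abc: "\<alpha> \<in> carrier K" "\<beta> \<in> carrier K" "\<gamma> \<in> carrier K"
    and nz: "\<alpha> \<noteq> \<zero>\<^bsub>K\<^esub> \<or> \<beta> \<noteq> \<zero>\<^bsub>K\<^esub> \<or> \<gamma> \<noteq> \<zero>\<^bsub>K\<^esub>"
    and rel: "\<alpha> \<odot> (x \<otimes> y) \<oplus> \<beta> \<odot> (x \<otimes> z) \<oplus> \<gamma> \<odot> (y \<otimes> z) = \<zero>"
    using dependent[OF 2] by blast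
  have sq: "x \<otimes> x = \<zero>" "y \<otimes> y = \<zero>" "z \<otimes> z = \<zero>"
    using assms square_zero by auto
  consider "\<alpha> \<noteq> \<zero>\<^bsub>K\<^esub>" | "\<beta> \<noteq> \<zero>\<^bsub>K\<^esub>" | "\<gamma> \<noteq> \<zero>\<^bsub>K\<^esub>"
    using nz by blast
  thus ?thesis
  proof cases
    case 1
    have "\<alpha> \<odot> (x \<otimes> (y \<otimes> z)) = (\<alpha> \<odot> (x \<otimes> y) \<oplus> \<beta> \<odot> (x \<otimes> z) \<oplus> \<gamma> \<odot> (y \<otimes> z)) \<otimes> z"
      using abc c sq by (simp add: l_distr smult_mult m_assoc smult_r_null)
    thus ?thesis
      using 1 abc c rel smult_eq_zero by simp
  next
    case 2
    have zy: "z \<otimes> y = \<ominus> (y \<otimes> z)"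
      using anticommute assms by blast
    have yzy: "y \<otimes> (z \<otimes> y) = \<zero>"
      using c sq by (simp add: zy r_minus m_assoc[symmetric])
    have xzy: "x \<otimes> (z \<otimes> y) = \<ominus> (x \<otimes> (y \<otimes> z))"
      using c by (simp add: zy r_minus)
    have "\<beta> \<odot> (x \<otimes> (z \<otimes> y)) = (\<alpha> \<odot> (x \<otimes> y) \<oplus> \<beta> \<odot> (x \<otimes> z) \<oplus> \<gamma> \<odot> (y \<otimes> z)) \<otimes> y"
      using abc c sq yzy by (simp add: l_distr smult_mult m_assoc smult_r_null)
    hence "x \<otimes> (z \<otimes> y) = \<zero>"
      using 2 abc c rel smult_eq_zero by simp
    thus ?thesis
      using xzy c by (metis add.inv_eq_1_iff m_closed)
  next
    case 3
    have "\<gamma> \<odot> (x \<otimes> (y \<otimes> z)) = x \<otimes> (\<alpha> \<odot> (x \<otimes> y) \<oplus> \<beta> \<odot> (x \<otimes> z) \<oplus> \<gamma> \<odot> (y \<otimes> z))"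
      using abc c sq by (simp add: r_distr smult_mult m_assoc[symmetric] smult_r_null)
    thus ?thesis
      using 3 abc c rel smult_eq_zero by simp
  qed
qed

lemma component_2_products: "component A 2 \<subseteq> component A 1 \<cdot> component A 1"
  using generated[of 1] by (simp add: numeral_2_eq_2)

text \<open>Degree 3 consists of sums of triple products; from there zero propagates upwards, since
  each component is generated by degree 1 and the preceding component.\<close>

lemma component_zero_above:
  assumes "3 \<le> n"
  shows "component A n = {\<zero>}"
proof -
  have 2: "x \<otimes> y = \<zero>" if "x \<in> component A 1" "y \<in> component A 1 \<cdot> component A 1" for x y
    using that(2)
  proof (induction rule: ideal_prod.induct)
    case (prod i j)
    then show ?case
      using that(1) triple_product by blast
  next
    case (sum s1 s2)
    have "s \<in> carrier A" if "s \<in> component A 1 \<cdot> component A 1" for s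
      using that by induction auto
    with sum that(1) show ?case
      by (simp add: r_distr)
  qed
  have "component A n \<subseteq> {\<zero>}"
    using assms
  proof (induction n rule: dec_induct)
    case base
    have "x = \<zero>" if "x \<in> component A 1 \<cdot> component A 2" for x
      using that by induction (use 2 component_2_products in auto)
    thus ?case
      using generated[of 2] by (auto simp: numeral_3_eq_3 numeral_2_eq_2)
  next
    case (step n)
    have "x = \<zero>" if "x \<in> component A 1 \<cdot> component A n" for x
      using that by induction (use step.IH in auto)
    thus ?case
      using generated[of n] step.hyps by auto
  qed
  thus ?thesis
    by auto
qed

section \<open>Homogeneous decomposition in degrees 0, 1 and 2\<close>

text \<open>Replaces a sum over a support that varies with \<open>c\<close> by a fixed sum of three
  terms, so that elements and graded ideals can be treated by triples.\<close>

lemma decomposition_sum: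
  assumes "\<forall>n. c n \<in> component A n"
  shows "(\<Oplus>n\<in>{n. c n \<noteq> \<zero>}. c n) = c 0 \<oplus> c 1 \<oplus> c 2"
proof -
  have c: "c n \<in> carrier A" for n
    using assms component_carrier by blast
  have "n \<in> {0,1,2}" if "c n \<noteq> \<zero>" for n
    using that assms component_zero_above[of n] by (cases "3 \<le> n") auto
  hence s: "{n. c n \<noteq> \<zero>} \<subseteq> {0,1,2}" by auto
  have "(\<Oplus>n\<in>{n. c n \<noteq> \<zero>}. c n) = (\<Oplus>n\<in>{0,1,2}. c n)"
    using c by (intro add.finprod_mono_neutral_cong_left s) auto
  also have "\<dots> = c 0 \<oplus> c 1 \<oplus> c 2"
    using c by (simp add: a_assoc)
  finally show ?thesis .
qed

lemma decomposition:
  assumes "x \<in> carrier A"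
  obtains x0 x1 x2 where "x0 \<in> component A 0" "x1 \<in> component A 1" "x2 \<in> component A 2"
    "x = x0 \<oplus> x1 \<oplus> x2"
proof -
  obtain c where "\<forall>n. c n \<in> component A n" "x = (\<Oplus>n\<in>{n. c n \<noteq> \<zero>}. c n)"
    using graded assms unfolding graded_algebra_def by blast
  thus thesis
    using that decomposition_sum by blast
qed

lemma graded_ideal_parts:
  assumes "graded_ideal A I" "x0 \<in> component A 0" "x1 \<in> component A 1" "x2 \<in> component A 2"
    and "x0 \<oplus> x1 \<oplus> x2 \<in> I"
  shows "x0 \<in> I" "x1 \<in> I" "x2 \<in> I"
proof -
  \<comment> \<open>The triple is padded by zeros to a family over all degrees, the form in which
    \<open>graded_ideal\<close> is stated.\<close>
  define c where "c n = (if n = 0 then x0 else if n = 1 then x1 else if n = 2 then x2 else \<zero>)" for n :: nat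
  have c: "\<forall>n. c n \<in> component A n"
    using assms by (auto simp: c_def)
  have "{n. c n \<noteq> \<zero>} \<subseteq> {0,1,2}"
    by (auto simp: c_def)
  hence fin: "finite {n. c n \<noteq> \<zero>}"
    by (rule finite_subset) simp
  have "(\<Oplus>n\<in>{n. c n \<noteq> \<zero>}. c n) \<in> I"
    unfolding decomposition_sum[OF c] using assms(5) by (simp add: c_def)
  hence "\<forall>n. c n \<in> I"
    using assms(1) c fin unfolding graded_ideal_def by blast
  from this[rule_format, of 0] this[rule_format, of 1] this[rule_format, of 2]
  show "x0 \<in> I" "x1 \<in> I" "x2 \<in> I"
    by (auto simp: c_def)
qed

lemma mult_zero_above:
  assumes "x \<in> component A m" "y \<in> component A n" "3 \<le> m + n"
  shows "x \<otimes> y = \<zero>"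
  using component_mult[OF assms(1,2) refl] component_zero_above[OF assms(3)] by blast

text \<open>A scalar acts as multiplication by \<open>c \<odot> \<one>\<close>, so every ring ideal
  is a subspace.\<close>

lemma ideal_smult_closed:
  assumes "ideal I A" "c \<in> carrier K" "w \<in> I"
  shows "c \<odot> w \<in> I"
proof -
  interpret I: ideal I A by fact
  have "c \<odot> w = (c \<odot> \<one>) \<otimes> w"
    using assms(2,3) I.a_subset by (subst smult_mult) auto
  thus ?thesis
    using assms(2,3) by (simp add: I.I_l_closed)
qed

text \<open>If \<open>V = A\<^sub>1\<close> and \<open>U\<close> is the annihilator of \<open>b\<close> modulo \<open>I\<close>, then either \<open>U\<close> has
  codimension at most one in \<open>V\<close>, and \<open>V U = V V\<close> because squares vanish, or \<open>V b\<close>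
  is at least two-dimensional and hence all of \<open>A\<^sub>2\<close>; in this case use \<open>b \<in> U\<close>.\<close>

lemma component_2_annihilator:
  assumes "ideal I A" "b \<in> component A 1"
  defines "U \<equiv> {a \<in> component A 1. a \<otimes> b \<in> I}"
  shows "component A 2 \<subseteq> component A 1 \<cdot> U"
proof (cases "U = component A 1")
  case True
  thus ?thesis
    using component_2_products by simp
next
  case False
  interpret I: ideal I A by fact
  have b: "b \<in> carrier A" and bU: "b \<in> U"
    using assms(2) square_zero by (auto simp: U_def)
  note smult_I = ideal_smult_closed[OF assms(1)]
  have U_smult: "c \<odot> u \<in> U" if "c \<in> carrier K" "u \<in> U" for c u
    using that b by (auto simp: U_def smult_mult smult_I)
  have U_add: "u \<oplus> v \<in> U" if "u \<in> U" "v \<in> U" for u v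
    using that b by (auto simp: U_def l_distr)
  obtain x where x: "x \<in> component A 1" "x \<otimes> b \<notin> I"
    using False by (auto simp: U_def)
  show ?thesis
  proof (cases "\<forall>y\<in>component A 1. \<exists>c\<in>carrier K. \<exists>u\<in>U. y = c \<odot> x \<oplus> u")
    case True
    have *: "i \<otimes> j \<in> component A 1 \<cdot> U" if ij: "i \<in> component A 1" "j \<in> component A 1" for i j
    proof -
      obtain c u d v where cd: "c \<in> carrier K" "d \<in> carrier K" and uv: "u \<in> U" "v \<in> U"
        and i: "i = c \<odot> x \<oplus> u" and j: "j = d \<odot> x \<oplus> v"
        using True ij by metis
      have uv': "u \<in> component A 1" "v \<in> component A 1"
        using uv by (auto simp: U_def)
      \<comment> \<open>Modulo terms with right factor in \<open>U\<close> only a multiple of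
        \<open>x \<otimes> x\<close>, which vanishes, and a term with left factor \<open>u\<close>
        remain; anticommutativity moves \<open>u\<close> to the right.\<close>
      have "i \<otimes> j = i \<otimes> (d \<odot> x) \<oplus> i \<otimes> v"
        using ij cd x uv' by (simp add: j r_distr)
      also have "i \<otimes> (d \<odot> x) = u \<otimes> (d \<odot> x)"
        using cd x uv' square_zero by (simp add: i l_distr smult_mult smult_r_null)
      also have "\<dots> = (\<ominus> (d \<odot> x)) \<otimes> u"
        using anticommute[of "d \<odot> x" u] cd x uv' by (simp add: l_minus)
      finally show ?thesis
        using ij cd x uv by (auto intro!: ideal_prod.intros)
    qed
    have "y \<in> component A 1 \<cdot> U" if "y \<in> component A 1 \<cdot> component A 1" for y
      using that by induction (blast intro: * ideal_prod.sum)+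
    thus ?thesis
      using component_2_products by blast
  next
    case False
    then obtain y where y: "y \<in> component A 1"
      and nU: "\<And>c u. \<lbrakk>c \<in> carrier K; u \<in> U\<rbrakk> \<Longrightarrow> y \<noteq> c \<odot> x \<oplus> u"
      by blast
    show ?thesis
    proof
      fix z assume z: "z \<in> component A 2"
      have 2: "x \<otimes> b \<in> component A 2" "y \<otimes> b \<in> component A 2"
        using x y assms(2) by (auto intro: component_mult)
      obtain \<alpha> \<beta> \<gamma> where abc: "\<alpha> \<in> carrier K" "\<beta> \<in> carrier K" "\<gamma> \<in> carrier K"
        and nz: "\<alpha> \<noteq> \<zero>\<^bsub>K\<^esub> \<or> \<beta> \<noteq> \<zero>\<^bsub>K\<^esub> \<or> \<gamma> \<noteq> \<zero>\<^bsub>K\<^esub>"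
        and rel: "\<alpha> \<odot> z \<oplus> \<beta> \<odot> (x \<otimes> b) \<oplus> \<gamma> \<odot> (y \<otimes> b) = \<zero>"
        using dependent[OF z 2] by blast
      have c: "x \<in> carrier A" "y \<in> carrier A" "z \<in> carrier A"
        using x y z by auto
      \<comment> \<open>If \<open>\<alpha>\<close> vanished, the relation would involve
        \<open>x \<otimes> b\<close> and \<open>y \<otimes> b\<close> alone. It would make
        \<open>x \<otimes> b\<close> zero, hence an element of \<open>I\<close>, or put
        \<open>y\<close> minus a multiple of \<open>x\<close> into \<open>U\<close>, against the
        choices of \<open>x\<close> and \<open>y\<close>.\<close>
      have "\<alpha> \<noteq> \<zero>\<^bsub>K\<^esub>"
      proof
        assume \<alpha>: "\<alpha> = \<zero>\<^bsub>K\<^esub>"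
        have rel': "\<gamma> \<odot> (y \<otimes> b) \<oplus> \<beta> \<odot> (x \<otimes> b) = \<zero>"
          using rel abc b c by (simp add: \<alpha> smult_l_null a_comm)
        show False
        proof (cases "\<gamma> = \<zero>\<^bsub>K\<^esub>")
          case True
          hence "x \<otimes> b = \<zero>"
            using smult_eq_zero[of \<beta> "x \<otimes> b"] rel' nz \<alpha> abc b c by (simp add: smult_l_null)
          thus False
            using x by simp
        next
          case False
          define \<delta> where "\<delta> = \<ominus>\<^bsub>K\<^esub> (inv\<^bsub>K\<^esub> \<gamma>) \<otimes>\<^bsub>K\<^esub> \<beta>"
          have inv: "(inv\<^bsub>K\<^esub> \<gamma>) \<in> carrier K"
            using False abc K.field_Units by auto
          hence \<delta>: "\<delta> \<in> carrier K"
            using abc by (simp add: \<delta>_def)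
          have "y \<otimes> b = (\<ominus>\<^bsub>K\<^esub> (inv\<^bsub>K\<^esub> \<gamma>)) \<odot> (\<beta> \<odot> (x \<otimes> b))"
            using abc b c rel' by (intro smult_solve False) auto
          hence "y \<otimes> b = \<delta> \<odot> (x \<otimes> b)"
            using abc b c inv unfolding \<delta>_def by (subst smult_assoc1) auto
          hence "(y \<oplus> \<ominus> (\<delta> \<odot> x)) \<otimes> b = \<zero>"
            using b c \<delta> by (simp add: l_distr l_minus smult_mult r_neg)
          hence "y \<oplus> \<ominus> (\<delta> \<odot> x) \<in> U"
            using x y \<delta> by (simp add: U_def)
          moreover have "y = \<delta> \<odot> x \<oplus> (y \<oplus> \<ominus> (\<delta> \<odot> x))"
            using c \<delta> by (simp add: a_comm[of y] r_neg1 a_assoc[symmetric] r_neg)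
          ultimately show False
            using nU \<delta> by blast
        qed
      qed
      hence inv: "(inv\<^bsub>K\<^esub> \<alpha>) \<in> carrier K"
        using abc K.field_Units by auto
      have "z = (\<ominus>\<^bsub>K\<^esub> (inv\<^bsub>K\<^esub> \<alpha>)) \<odot> (\<beta> \<odot> (x \<otimes> b) \<oplus> \<gamma> \<odot> (y \<otimes> b))"
        using abc b c rel \<open>\<alpha> \<noteq> \<zero>\<^bsub>K\<^esub>\<close> by (intro smult_solve) (auto simp: a_assoc)
      also have "\<dots> = ((\<ominus>\<^bsub>K\<^esub> (inv\<^bsub>K\<^esub> \<alpha>)) \<odot> (\<beta> \<odot> x \<oplus> \<gamma> \<odot> y)) \<otimes> b"
        using abc b c inv by (simp add: smult_mult l_distr)
      finally show "z \<in> component A 1 \<cdot> U"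
        using bU abc x y inv by (auto intro!: ideal_prod.prod)
    qed
  qed
qed

section \<open>Principal ideals and colon ideals\<close>

text \<open>Multiples of \<open>c \<odot> b \<oplus> y\<close> by positive degree fall into degree 2
  or vanish, so these elements form an ideal. The upper bound suffices for colon ideals, because
  elements of positive degree annihilate degree 2.\<close>

lemma principal_ideal_subset:
  assumes "b \<in> component A 1" "x \<in> Idl {b}"
  obtains c y where "c \<in> carrier K" "y \<in> component A 2" "x = c \<odot> b \<oplus> y"
proof -
  have b: "b \<in> carrier A"
    using assms by simp
  let ?L = "{c \<odot> b \<oplus> y | c y. c \<in> carrier K \<and> y \<in> component A 2}"
  have "ideal ?L A"
  proof (rule idealI[OF ring_axioms])
    have "submodule ?L K A"
    proof (rule submoduleI)
      show "?L \<subseteq> carrier A"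
        using b by auto
      show "\<zero> \<in> ?L"
        using b by (auto intro!: exI[of _ "\<zero>\<^bsub>K\<^esub>"] exI[of _ "\<zero>"] simp: smult_l_null)
    next
      fix a assume "a \<in> ?L"
      then obtain c y where cy: "c \<in> carrier K" "y \<in> component A 2" "a = c \<odot> b \<oplus> y"
        by blast
      hence "\<ominus> a = (\<ominus>\<^bsub>K\<^esub> c) \<odot> b \<oplus> \<ominus> y"
        using b by (simp add: smult_l_minus minus_add)
      thus "\<ominus> a \<in> ?L"
        using cy K.a_inv_closed component_uminus by blast
    next
      fix a a' assume "a \<in> ?L" "a' \<in> ?L"
      then obtain c y c' y' where cy: "c \<in> carrier K" "y \<in> component A 2" "a = c \<odot> b \<oplus> y"
         "c' \<in> carrier K" "y' \<in> component A 2" "a' = c' \<odot> b \<oplus> y'"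
        by blast
      hence "a \<oplus> a' = (c \<oplus>\<^bsub>K\<^esub> c') \<odot> b \<oplus> (y \<oplus> y')"
        using b by (simp add: smult_l_distr a_ac)
      thus "a \<oplus> a' \<in> ?L"
        using cy K.a_closed component_add by blast
    next
      fix d a assume d: "d \<in> carrier K" and "a \<in> ?L"
      then obtain c y where cy: "c \<in> carrier K" "y \<in> component A 2" "a = c \<odot> b \<oplus> y"
        by blast
      hence "d \<odot> a = (d \<otimes>\<^bsub>K\<^esub> c) \<odot> b \<oplus> d \<odot> y"
        using b d by (simp add: smult_r_distr smult_assoc1)
      thus "d \<odot> a \<in> ?L"
        using cy d K.m_closed component_smult by blast
    qed
    thus "subgroup ?L (add_monoid A)"
      by (rule submodule.axioms)
  next
    fix a r assume "a \<in> ?L" and r: "r \<in> carrier A"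
    then obtain c y where cy: "c \<in> carrier K" "y \<in> component A 2" "a = c \<odot> b \<oplus> y"
      by blast
    obtain r0 r1 r2 where rs: "r0 \<in> component A 0" "r1 \<in> component A 1" "r2 \<in> component A 2"
      "r = r0 \<oplus> r1 \<oplus> r2"
      using r by (rule decomposition)
    obtain d where d: "d \<in> carrier K" "r0 = d \<odot> \<one>"
      using component_0E rs(1) by blast
    have cb: "c \<odot> b \<in> component A 1"
      using cy assms by simp
    have z: "r1 \<otimes> y = \<zero>" "r2 \<otimes> y = \<zero>" "r2 \<otimes> (c \<odot> b) = \<zero>"
        "y \<otimes> r1 = \<zero>" "y \<otimes> r2 = \<zero>" "(c \<odot> b) \<otimes> r2 = \<zero>"
      using rs cy cb by (auto intro: mult_zero_above)
    have r0: "r0 \<otimes> w = d \<odot> w" "w \<otimes> r0 = d \<odot> w" if "w \<in> carrier A" for w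
      using d that by (simp_all add: smult_mult)
    have car: "r1 \<in> carrier A" "r2 \<in> carrier A" "y \<in> carrier A" "c \<odot> b \<in> carrier A" "r0 \<in> carrier A"
      using rs cy cb by auto
    have dc: "d \<otimes>\<^bsub>K\<^esub> c \<in> carrier K" "\<And>w. w \<in> component A 2 \<Longrightarrow> d \<odot> y \<oplus> w \<in> component A 2"
      using d(1) cy by auto
    have "r \<otimes> a = (r0 \<otimes> (c \<odot> b) \<oplus> r0 \<otimes> y) \<oplus> (r1 \<otimes> (c \<odot> b) \<oplus> r1 \<otimes> y) \<oplus> (r2 \<otimes> (c \<odot> b) \<oplus> r2 \<otimes> y)"
      using car unfolding cy(3) rs(4) by algebra
    also have "\<dots> = (d \<otimes>\<^bsub>K\<^esub> c) \<odot> b \<oplus> (d \<odot> y \<oplus> r1 \<otimes> (c \<odot> b))"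
      using car d(1) b cy(1) by (simp add: r0 z smult_assoc1 a_assoc)
    finally show "r \<otimes> a \<in> ?L"
      using dc component_mult[OF rs(2) cb, of 2] by (auto simp del: component_add)
    have "a \<otimes> r = ((c \<odot> b) \<otimes> r0 \<oplus> y \<otimes> r0) \<oplus> ((c \<odot> b) \<otimes> r1 \<oplus> y \<otimes> r1) \<oplus> ((c \<odot> b) \<otimes> r2 \<oplus> y \<otimes> r2)"
      using car unfolding cy(3) rs(4) by algebra
    also have "\<dots> = (d \<otimes>\<^bsub>K\<^esub> c) \<odot> b \<oplus> (d \<odot> y \<oplus> (c \<odot> b) \<otimes> r1)"
      using car d(1) b cy(1) by (simp add: r0 z smult_assoc1 a_assoc)
    finally show "a \<otimes> r \<in> ?L"
      using dc component_mult[OF cb rs(2), of 2] by (auto simp del: component_add)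
  qed
  moreover have "b \<in> ?L"
    using b by (auto intro!: exI[of _ "\<one>\<^bsub>K\<^esub>"] exI[of _ "\<zero>"])
  ultimately have "Idl {b} \<subseteq> ?L"
    by (intro genideal_minimal) auto
  thus thesis
    using assms(2) that by blast
qed

text \<open>Multiply by \<open>b\<close> and compare degrees: a nonzero scalar part
  \<open>a0\<close> could be inverted and would put \<open>b\<close> into \<open>I\<close>, while
  \<open>a2\<close> annihilates all positive degrees and is unrestricted. Conversely, only
  \<open>a1 \<otimes> b\<close> contributes to a product with
  \<open>c \<odot> b \<oplus> y\<close>.\<close>

lemma colon_ideal_iff:
  assumes "graded_ideal A I" "b \<in> component A 1" "b \<notin> I"
    and a: "a0 \<in> component A 0" "a1 \<in> component A 1" "a2 \<in> component A 2"
  shows "a0 \<oplus> a1 \<oplus> a2 \<in> colon_ideal A I (Idl {b}) \<longleftrightarrow> a0 = \<zero> \<and> a1 \<otimes> b \<in> I"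
proof -
  interpret I: ideal I A
    using assms(1) by (simp add: graded_ideal_def)
  have b: "b \<in> carrier A"
    using assms by simp
  have car: "a0 \<in> carrier A" "a1 \<in> carrier A" "a2 \<in> carrier A"
    using a by auto
  note smult_I = ideal_smult_closed[OF I.ideal_axioms]
  show ?thesis
  proof
    assume "a0 \<oplus> a1 \<oplus> a2 \<in> colon_ideal A I (Idl {b})"
    hence "(a0 \<oplus> a1 \<oplus> a2) \<otimes> b \<in> I"
      using genideal_self'[OF b] by (simp add: colon_ideal_def)
    \<comment> \<open>The summand \<open>\<zero>\<close> is kept as the degree 0 part, to match the
      shape of \<open>graded_ideal_parts\<close>.\<close>
    moreover have "(a0 \<oplus> a1 \<oplus> a2) \<otimes> b = \<zero> \<oplus> a0 \<otimes> b \<oplus> a1 \<otimes> b"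
      using car b mult_zero_above[OF a(3) assms(2)] by (simp add: l_distr)
    ultimately have "\<zero> \<oplus> a0 \<otimes> b \<oplus> a1 \<otimes> b \<in> I"
      by simp
    moreover have "a0 \<otimes> b \<in> component A 1" "a1 \<otimes> b \<in> component A 2"
      using a assms(2) by (auto intro: component_mult)
    ultimately have ab: "a0 \<otimes> b \<in> I" "a1 \<otimes> b \<in> I"
      using graded_ideal_parts(2,3)[OF assms(1) component_zero] by blast+
    obtain c where c: "c \<in> carrier K" "a0 = c \<odot> \<one>"
      using component_0E a(1) by blast
    have "c = \<zero>\<^bsub>K\<^esub>"
    proof (rule ccontr)
      assume nz: "c \<noteq> \<zero>\<^bsub>K\<^esub>"
      have inv: "(inv\<^bsub>K\<^esub> c) \<in> carrier K" "(inv\<^bsub>K\<^esub> c) \<otimes>\<^bsub>K\<^esub> c = \<one>\<^bsub>K\<^esub>"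
        using c nz K.field_Units by (auto intro: K.Units_l_inv)
      have "b = (inv\<^bsub>K\<^esub> c) \<odot> (a0 \<otimes> b)"
        using b c inv by (simp add: smult_mult smult_assoc1[symmetric])
      thus False
        using smult_I[OF inv(1) ab(1)] assms(3) by simp
    qed
    thus "a0 = \<zero> \<and> a1 \<otimes> b \<in> I"
      using ab c by (simp add: smult_l_null)
  next
    assume *: "a0 = \<zero> \<and> a1 \<otimes> b \<in> I"
    have "(a0 \<oplus> a1 \<oplus> a2) \<otimes> x \<in> I" if x: "x \<in> Idl {b}" for x
    proof -
      obtain c y where cy: "c \<in> carrier K" "y \<in> component A 2" "x = c \<odot> b \<oplus> y"
        using principal_ideal_subset[OF assms(2) x] by blast
      have cb: "c \<odot> b \<in> component A 1"
        using cy assms by simp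
      have z: "a1 \<otimes> y = \<zero>" "a2 \<otimes> y = \<zero>" "a2 \<otimes> b = \<zero>"
        using a cy assms(2) by (auto intro: mult_zero_above)
      have "(a0 \<oplus> a1 \<oplus> a2) \<otimes> x = c \<odot> (a1 \<otimes> b)"
        using * car cy(1,2) b z by (simp add: cy(3) l_distr r_distr smult_mult)
      thus ?thesis
        using * cy smult_I by simp
    qed
    thus "a0 \<oplus> a1 \<oplus> a2 \<in> colon_ideal A I (Idl {b})"
      using car by (simp add: colon_ideal_def)
  qed
qed

text \<open>Closed under right multiplication because \<open>J\<close> absorbs factors on its left,
  under left multiplication because \<open>I\<close> does.\<close>

lemma ideal_colon_ideal:
  assumes "ideal I A" "ideal J A"
  shows "ideal (colon_ideal A I J) A"
proof -
  interpret I: ideal I A by fact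
  interpret J: ideal J A by fact
  have J: "x \<in> carrier A" if "x \<in> J" for x
    using that J.a_subset by blast
  show ?thesis
  proof (rule idealI[OF ring_axioms])
    show "subgroup (colon_ideal A I J) (add_monoid A)"
    proof (rule group.subgroupI)
      show "group (add_monoid A)"
        by (rule a_group)
      show "colon_ideal A I J \<subseteq> carrier (add_monoid A)"
        by (auto simp: colon_ideal_def)
      have "\<zero> \<in> colon_ideal A I J"
        using J by (simp add: colon_ideal_def)
      thus "colon_ideal A I J \<noteq> {}" by blast
    next
      fix a assume "a \<in> colon_ideal A I J"
      thus "inv\<^bsub>add_monoid A\<^esub> a \<in> colon_ideal A I J"
        using J unfolding a_inv_def[symmetric] by (auto simp: colon_ideal_def l_minus)
    next
      fix a a' assume "a \<in> colon_ideal A I J" "a' \<in> colon_ideal A I J"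
      thus "a \<otimes>\<^bsub>add_monoid A\<^esub> a' \<in> colon_ideal A I J"
        using J by (auto simp: colon_ideal_def l_distr)
    qed
  qed (use J in \<open>auto simp: colon_ideal_def m_assoc J.I_l_closed I.I_l_closed\<close>)
qed

text \<open>By \<open>colon_ideal_iff\<close> membership is tested degree by degree, so the colon
  ideal is graded; generation in degree 1 then rests on
  \<open>component_2_annihilator\<close>.\<close>

lemma colon_ideal_linear:
  assumes "graded_ideal A I" "b \<in> component A 1" "b \<notin> I"
  shows "colon_ideal A I (Idl {b}) \<in> linear_ideals A"
proof -
  let ?J = "colon_ideal A I (Idl {b})"
  define U where "U = {a \<in> component A 1. a \<otimes> b \<in> I}"
  note iff = colon_ideal_iff[OF assms]
  have I: "ideal I A"
    using assms(1) by (simp add: graded_ideal_def)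
  interpret J: ideal ?J A
    using I genideal_ideal[of "{b}"] assms(2) by (intro ideal_colon_ideal) auto
  have U: "?J \<inter> component A 1 = U"
    using iff[OF component_zero _ component_zero] by (auto simp: U_def)
  have A2: "x \<in> ?J" if "x \<in> component A 2" for x
    using iff[OF component_zero component_zero that] that I assms(2)
    by (simp add: additive_subgroup.zero_closed ideal.axioms(1))
  have A2U: "component A 2 \<subseteq> component A 1 \<cdot> U"
    unfolding U_def using I assms(2) by (rule component_2_annihilator)
  have mono: "component A 1 \<cdot> U \<subseteq> carrier A \<cdot> U"
  proof
    fix x assume "x \<in> component A 1 \<cdot> U"
    thus "x \<in> carrier A \<cdot> U"
      by induction (auto intro: ideal_prod.intros)
  qed
  have "?J \<subseteq> carrier A \<cdot> U"
  proof
    fix a assume aJ: "a \<in> ?J"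
    hence "a \<in> carrier A"
      using J.a_subset by blast
    then obtain a0 a1 a2 where a: "a0 \<in> component A 0" "a1 \<in> component A 1" "a2 \<in> component A 2"
        "a = a0 \<oplus> a1 \<oplus> a2"
      by (rule decomposition)
    hence "a0 = \<zero>" "a1 \<in> U"
      using aJ iff by (auto simp: U_def)
    hence "a = \<one> \<otimes> a1 \<oplus> a2"
      using a by simp
    thus "a \<in> carrier A \<cdot> U"
      using \<open>a1 \<in> U\<close> a(3) A2U mono by (auto intro!: ideal_prod.intros)
  qed
  moreover have "carrier A \<cdot> U \<subseteq> ?J"
  proof
    fix x assume "x \<in> carrier A \<cdot> U"
    thus "x \<in> ?J"
      by induction (use U in \<open>auto intro: J.I_l_closed\<close>)
  qed
  moreover have "graded_ideal A ?J"
    unfolding graded_ideal_def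
  proof (intro conjI allI impI, rule J.ideal_axioms, elim conjE)
    fix c n
    assume c: "\<forall>n. c n \<in> component A n" and J: "(\<Oplus>n\<in>{n. c n \<noteq> \<zero>}. c n) \<in> ?J"
    have "c 0 = \<zero>" "c 1 \<otimes> b \<in> I"
      using J iff[of "c 0" "c 1" "c 2"] c by (simp_all add: decomposition_sum[OF c])
    hence "c 0 = \<zero>" "c 1 \<in> ?J"
      using U c by (auto simp: U_def)
    moreover have "c n = \<zero>" if "n \<notin> {0,1,2}"
      using that c component_zero_above[of n] by auto
    ultimately show "c n \<in> ?J"
      using c A2 by (cases "n \<in> {0,1,2}") auto
  qed
  ultimately show ?thesis
    using U by (simp add: linear_ideals_def)
qed

lemma universally_koszulI: "quadratic_algebra K A \<Longrightarrow> universally_koszul K A"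
  using colon_ideal_linear by (auto simp: universally_koszul_def linear_ideals_def)

end

section \<open>Quadratic algebras are generated in degree one\<close>

lemma ideal_prod_hom_image:
  assumes "\<And>x y. \<lbrakk>x \<in> carrier R; y \<in> carrier R\<rbrakk> \<Longrightarrow> h (x \<otimes>\<^bsub>R\<^esub> y) = h x \<otimes>\<^bsub>S\<^esub> h y"
    and "\<And>x y. \<lbrakk>x \<in> carrier R; y \<in> carrier R\<rbrakk> \<Longrightarrow> h (x \<oplus>\<^bsub>R\<^esub> y) = h x \<oplus>\<^bsub>S\<^esub> h y"
    and "ring R" "I \<subseteq> carrier R" "J \<subseteq> carrier R"
  shows "h ` (I \<cdot>\<^bsub>R\<^esub> J) \<subseteq> h ` I \<cdot>\<^bsub>S\<^esub> h ` J"
proof -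
  interpret ring R by fact
  \<comment> \<open>Membership in the carrier is carried along because \<open>h\<close> respects the
    operations only there.\<close>
  have "x \<in> carrier R \<and> h x \<in> h ` I \<cdot>\<^bsub>S\<^esub> h ` J" if "x \<in> I \<cdot>\<^bsub>R\<^esub> J" for x
    using that
  proof induction
    case (prod i j)
    hence "i \<in> carrier R" "j \<in> carrier R" "h i \<otimes>\<^bsub>S\<^esub> h j \<in> h ` I \<cdot>\<^bsub>S\<^esub> h ` J"
      using assms(4,5) by (auto intro!: ideal_prod.prod)
    thus ?case
      using assms(1) by simp
  next
    case (sum s1 s2)
    thus ?case
      using assms(2) ideal_prod.sum[of "h s1" S _ _ "h s2"] by auto
  qed
  thus ?thesis by auto
qed

text \<open>\<open>quotient_algebra\<close> rebuilds the quotient ring as a larger record, so the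
  ring axioms are transferred field by field.\<close>

lemma ring_cong:
  assumes "ring R" "carrier S = carrier R" "monoid.mult S = monoid.mult R" "one S = one R"
    "zero S = zero R" "add S = add R"
  shows "ring S"
proof -
  interpret ring R by fact
  show ?thesis
    by (rule ringI; (intro abelian_groupI monoidI)?; unfold assms(2-))
      (auto simp: a_ac m_assoc l_distr r_distr intro: l_neg)
qed

lemma quotient_algebra_ring:
  assumes "ideal I A"
  shows "ring (quotient_algebra A I)"
  by (rule ring_cong[OF ideal.quotient_is_ring[OF assms]]) (simp_all add: quotient_algebra_def)

lemma quotient_algebra_hom:
  assumes "ideal I A"
  shows "(+>\<^bsub>A\<^esub>) I \<in> ring_hom A (quotient_algebra A I)"
  using ideal.rcos_ring_hom[OF assms] by (simp add: ring_hom_def quotient_algebra_def)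

lemma quotient_algebra_component:
  "component (quotient_algebra A I) n = (+>\<^bsub>A\<^esub>) I ` component A n"
  by (simp add: quotient_algebra_def)

text \<open>Transports generation in low degree along homomorphisms that are onto in each degree. It
  serves to pass from the free algebra through its quotients to a quadratic algebra.\<close>

lemma component_generated_image:
  assumes "h \<in> ring_hom A B" "ring A" "component A m \<subseteq> carrier A" "component A n \<subseteq> carrier A"
    and comp: "\<And>n. h ` component A n = component B n"
    and "component A k \<subseteq> component A m \<cdot>\<^bsub>A\<^esub> component A n"
  shows "component B k \<subseteq> component B m \<cdot>\<^bsub>B\<^esub> component B n"
proof -
  have "component B k \<subseteq> h ` (component A m \<cdot>\<^bsub>A\<^esub> component A n)"
    using assms(6) unfolding comp[symmetric] by blast
  also have "\<dots> \<subseteq> h ` component A m \<cdot>\<^bsub>B\<^esub> h ` component A n"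
    using assms by (intro ideal_prod_hom_image) (auto simp: ring_hom_mult ring_hom_add)
  finally show ?thesis
    unfolding comp .
qed

section \<open>The free algebra: ring axioms and generation by letters\<close>

locale free_algebra_over = field K for K :: "('k, 'n) ring_scheme" (structure) +
  fixes V :: "'v set"
begin

abbreviation "FA \<equiv> free_algebra K V"

lemma free_carrierI:
  assumes "\<And>w. f w \<in> carrier K" "finite S" "\<And>w. f w \<noteq> \<zero> \<Longrightarrow> w \<in> S \<and> set w \<subseteq> V"
  shows "f \<in> carrier FA"
proof -
  have "finite {w. f w \<noteq> \<zero>}"
    by (rule finite_subset[OF _ assms(2)]) (use assms(3) in auto)
  thus ?thesis
    using assms by (auto simp: free_algebra_def free_algebra_carrier_def)
qed

lemma free_carrierD:
  assumes "f \<in> carrier FA"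
  shows "f w \<in> carrier K" "finite {w. f w \<noteq> \<zero>}" "f w \<noteq> \<zero> \<Longrightarrow> set w \<subseteq> V"
  using assms by (auto simp: free_algebra_def free_algebra_carrier_def)

lemma free_algebra_simps:
  "\<zero>\<^bsub>FA\<^esub> = (\<lambda>w. \<zero>)" "\<one>\<^bsub>FA\<^esub> = (\<lambda>w. if w = [] then \<one> else \<zero>)"
  "f \<oplus>\<^bsub>FA\<^esub> g = (\<lambda>w. f w \<oplus> g w)" "c \<odot>\<^bsub>FA\<^esub> f = (\<lambda>w. c \<otimes> f w)"
  by (simp_all add: free_algebra_def)

lemma free_mult_eval: "(f \<otimes>\<^bsub>FA\<^esub> g) w = (\<Oplus>i\<in>{..length w}. f (take i w) \<otimes> g (drop i w))"
  by (simp add: free_algebra_def)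

lemma free_mult_Nil:
  assumes "\<And>w. f w \<in> carrier K" "\<And>w. g w \<in> carrier K"
  shows "(f \<otimes>\<^bsub>FA\<^esub> g) [] = f [] \<otimes> g []"
  using assms by (simp add: free_mult_eval)

text \<open>In a splitting of \<open>v # w\<close> the first part is empty or starts with
  \<open>v\<close>. This recursion replaces reindexing of sums by induction on words.\<close>

lemma free_mult_Cons:
  assumes "\<And>w. f w \<in> carrier K" "\<And>w. g w \<in> carrier K"
  shows "(f \<otimes>\<^bsub>FA\<^esub> g) (v # w) = f [] \<otimes> g (v # w) \<oplus> ((\<lambda>w. f (v # w)) \<otimes>\<^bsub>FA\<^esub> g) w"
  unfolding free_mult_eval using assms by (simp add: finsum_Suc2 a_comm del: finsum_Suc)

lemma free_mult_K:
  assumes "\<And>w. f w \<in> carrier K" "\<And>w. g w \<in> carrier K"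
  shows "(f \<otimes>\<^bsub>FA\<^esub> g) w \<in> carrier K"
  unfolding free_mult_eval using assms by simp

lemma free_mult_distr:
  assumes "\<And>w. f w \<in> carrier K" "\<And>w. g w \<in> carrier K" "\<And>w. h w \<in> carrier K"
  shows "((\<lambda>w. f w \<oplus> g w) \<otimes>\<^bsub>FA\<^esub> h) w = (f \<otimes>\<^bsub>FA\<^esub> h) w \<oplus> (g \<otimes>\<^bsub>FA\<^esub> h) w"
    and "(h \<otimes>\<^bsub>FA\<^esub> (\<lambda>w. f w \<oplus> g w)) w = (h \<otimes>\<^bsub>FA\<^esub> f) w \<oplus> (h \<otimes>\<^bsub>FA\<^esub> g) w"
  unfolding free_mult_eval using assms
  by (simp_all add: l_distr r_distr finsum_addf)

lemma free_mult_scale: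
  assumes "\<And>w. f w \<in> carrier K" "\<And>w. g w \<in> carrier K" "c \<in> carrier K"
  shows "((\<lambda>w. c \<otimes> f w) \<otimes>\<^bsub>FA\<^esub> g) w = c \<otimes> (f \<otimes>\<^bsub>FA\<^esub> g) w"
  unfolding free_mult_eval using assms
  by (simp add: m_assoc finsum_rdistr)

text \<open>The induction replaces \<open>f\<close> by its shift
  \<open>\<lambda>w. f (v # w)\<close>. Therefore the product laws are stated pointwise for
  arbitrary functions with values in \<open>K\<close>, without conditions on supports.\<close>

lemma free_mult_assoc:
  assumes "\<And>w. f w \<in> carrier K" "\<And>w. g w \<in> carrier K" "\<And>w. h w \<in> carrier K"
  shows "((f \<otimes>\<^bsub>FA\<^esub> g) \<otimes>\<^bsub>FA\<^esub> h) w = (f \<otimes>\<^bsub>FA\<^esub> (g \<otimes>\<^bsub>FA\<^esub> h)) w"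
  using assms(1)
proof (induction w arbitrary: f)
  case Nil
  then show ?case
    using assms by (simp add: free_mult_Nil free_mult_K m_assoc)
next
  case (Cons v w)
  note K = Cons.prems assms free_mult_K
  have "(\<lambda>w. (f \<otimes>\<^bsub>FA\<^esub> g) (v # w)) = (\<lambda>w. f [] \<otimes> g (v # w) \<oplus> ((\<lambda>w. f (v # w)) \<otimes>\<^bsub>FA\<^esub> g) w)"
    using K by (simp add: free_mult_Cons)
  hence "((f \<otimes>\<^bsub>FA\<^esub> g) \<otimes>\<^bsub>FA\<^esub> h) (v # w) = f [] \<otimes> g [] \<otimes> h (v # w) \<oplus>
      (f [] \<otimes> ((\<lambda>w. g (v # w)) \<otimes>\<^bsub>FA\<^esub> h) w \<oplus> (((\<lambda>w. f (v # w)) \<otimes>\<^bsub>FA\<^esub> g) \<otimes>\<^bsub>FA\<^esub> h) w)"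
    using K by (simp add: free_mult_Cons[of "f \<otimes>\<^bsub>FA\<^esub> g"] free_mult_Nil free_mult_distr free_mult_scale)
  also have "\<dots> = f [] \<otimes> (g [] \<otimes> h (v # w) \<oplus> ((\<lambda>w. g (v # w)) \<otimes>\<^bsub>FA\<^esub> h) w) \<oplus>
      ((\<lambda>w. f (v # w)) \<otimes>\<^bsub>FA\<^esub> (g \<otimes>\<^bsub>FA\<^esub> h)) w"
    using K Cons.IH[of "\<lambda>w. f (v # w)"] by (simp add: r_distr m_assoc a_assoc)
  also have "\<dots> = (f \<otimes>\<^bsub>FA\<^esub> (g \<otimes>\<^bsub>FA\<^esub> h)) (v # w)"
    using K by (simp add: free_mult_Cons)
  finally show ?case .
qed

lemma free_one_mult:
  assumes "\<And>w. f w \<in> carrier K"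
  shows "(\<one>\<^bsub>FA\<^esub> \<otimes>\<^bsub>FA\<^esub> f) w = f w"
proof (cases w)
  case Nil
  thus ?thesis
    using assms by (simp add: free_mult_Nil free_algebra_simps)
next
  case (Cons v u)
  have "((\<lambda>w. \<zero>) \<otimes>\<^bsub>FA\<^esub> f) u = \<zero>"
    using assms by (simp add: free_mult_eval)
  thus ?thesis
    using assms by (simp add: Cons free_mult_Cons free_algebra_simps)
qed

lemma free_mult_one:
  assumes "\<And>w. f w \<in> carrier K"
  shows "(f \<otimes>\<^bsub>FA\<^esub> \<one>\<^bsub>FA\<^esub>) w = f w"
  using assms
  by (induction w arbitrary: f) (simp_all add: free_mult_Nil free_mult_Cons free_algebra_simps)

text \<open>For closure under products: the support consists of concatenations of words from two
  finite supports, again with letters in \<open>V\<close>.\<close>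

lemma free_mult_support:
  assumes "\<And>w. f w \<in> carrier K" "\<And>w. g w \<in> carrier K" "(f \<otimes>\<^bsub>FA\<^esub> g) w \<noteq> \<zero>"
  obtains u v where "w = u @ v" "f u \<noteq> \<zero>" "g v \<noteq> \<zero>"
proof -
  have "\<exists>i\<le>length w. f (take i w) \<otimes> g (drop i w) \<noteq> \<zero>"
  proof (rule ccontr)
    assume "\<not> ?thesis"
    hence "(f \<otimes>\<^bsub>FA\<^esub> g) w = (\<Oplus>i\<in>{..length w}. \<zero>)"
      unfolding free_mult_eval by (intro finsum_cong') auto
    thus False
      using assms(3) by simp
  qed
  then obtain i where i: "f (take i w) \<otimes> g (drop i w) \<noteq> \<zero>"
    by blast
  hence "f (take i w) \<noteq> \<zero>" "g (drop i w) \<noteq> \<zero>"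
    using assms(1,2) by auto
  thus thesis
    using that[of "take i w" "drop i w"] by simp
qed

lemma free_algebra_ring: "ring FA"
proof (rule ringI)
  show "abelian_group FA"
  proof (rule abelian_groupI)
    fix f g assume f: "f \<in> carrier FA" and g: "g \<in> carrier FA"
    show "f \<oplus>\<^bsub>FA\<^esub> g \<in> carrier FA"
      unfolding free_algebra_simps
    proof (rule free_carrierI[where S = "{w. f w \<noteq> \<zero>} \<union> {w. g w \<noteq> \<zero>}"])
      fix w
      show "f w \<oplus> g w \<in> carrier K"
        using f g by (simp add: free_carrierD(1))
      assume "f w \<oplus> g w \<noteq> \<zero>"
      hence "f w \<noteq> \<zero> \<or> g w \<noteq> \<zero>"
        by auto
      thus "w \<in> {w. f w \<noteq> \<zero>} \<union> {w. g w \<noteq> \<zero>} \<and> set w \<subseteq> V"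
        using free_carrierD(3)[OF f] free_carrierD(3)[OF g] by auto
    qed (use f g in \<open>simp add: free_carrierD(2)\<close>)
    show "f \<oplus>\<^bsub>FA\<^esub> g = g \<oplus>\<^bsub>FA\<^esub> f"
      using f g by (simp add: free_algebra_simps free_carrierD a_comm)
    fix h assume h: "h \<in> carrier FA"
    show "f \<oplus>\<^bsub>FA\<^esub> g \<oplus>\<^bsub>FA\<^esub> h = f \<oplus>\<^bsub>FA\<^esub> (g \<oplus>\<^bsub>FA\<^esub> h)"
      using f g h by (simp add: free_algebra_simps free_carrierD a_assoc)
  next
    show "\<zero>\<^bsub>FA\<^esub> \<in> carrier FA"
      by (intro free_carrierI[where S = "{}"]) (auto simp: free_algebra_simps)
    fix f assume f: "f \<in> carrier FA"
    show "\<zero>\<^bsub>FA\<^esub> \<oplus>\<^bsub>FA\<^esub> f = f"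
      using f by (simp add: free_algebra_simps free_carrierD)
    have "(\<lambda>w. \<ominus> f w) \<in> carrier FA"
    proof (rule free_carrierI[where S = "{w. f w \<noteq> \<zero>}"])
      fix w
      show "\<ominus> f w \<in> carrier K"
        using f by (simp add: free_carrierD(1))
      assume "\<ominus> f w \<noteq> \<zero>"
      hence "f w \<noteq> \<zero>"
        by auto
      thus "w \<in> {w. f w \<noteq> \<zero>} \<and> set w \<subseteq> V"
        using free_carrierD(3)[OF f] by auto
    qed (use f in \<open>simp add: free_carrierD(2)\<close>)
    moreover have "(\<lambda>w. \<ominus> f w) \<oplus>\<^bsub>FA\<^esub> f = \<zero>\<^bsub>FA\<^esub>"
      using f by (simp add: free_algebra_simps free_carrierD l_neg)
    ultimately show "\<exists>g\<in>carrier FA. g \<oplus>\<^bsub>FA\<^esub> f = \<zero>\<^bsub>FA\<^esub>"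
      by blast
  qed
  show "Group.monoid FA"
  proof (rule monoidI)
    show "\<one>\<^bsub>FA\<^esub> \<in> carrier FA"
      by (intro free_carrierI[where S = "{[]}"]) (auto simp: free_algebra_simps split: if_splits)
    fix f assume f: "f \<in> carrier FA"
    show "\<one>\<^bsub>FA\<^esub> \<otimes>\<^bsub>FA\<^esub> f = f" "f \<otimes>\<^bsub>FA\<^esub> \<one>\<^bsub>FA\<^esub> = f"
      using f by (auto simp: fun_eq_iff free_one_mult free_mult_one free_carrierD)
    fix g assume g: "g \<in> carrier FA"
    show "f \<otimes>\<^bsub>FA\<^esub> g \<in> carrier FA"
    proof (rule free_carrierI[where S = "(\<lambda>(u, v). u @ v) ` ({w. f w \<noteq> \<zero>} \<times> {w. g w \<noteq> \<zero>})"])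
      show "finite ((\<lambda>(u, v). u @ v) ` ({w. f w \<noteq> \<zero>} \<times> {w. g w \<noteq> \<zero>}))"
        using f g by (simp add: free_carrierD)
      fix w
      show "(f \<otimes>\<^bsub>FA\<^esub> g) w \<in> carrier K"
        using f g by (intro free_mult_K) (auto simp: free_carrierD)
      assume "(f \<otimes>\<^bsub>FA\<^esub> g) w \<noteq> \<zero>"
      then obtain u v where "w = u @ v" "f u \<noteq> \<zero>" "g v \<noteq> \<zero>"
        using free_mult_support f g free_carrierD(1) by metis
      thus "w \<in> (\<lambda>(u, v). u @ v) ` ({w. f w \<noteq> \<zero>} \<times> {w. g w \<noteq> \<zero>}) \<and> set w \<subseteq> V"
        using free_carrierD(3)[OF f, of u] free_carrierD(3)[OF g, of v] by auto
    qed
    fix h assume h: "h \<in> carrier FA"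
    show "f \<otimes>\<^bsub>FA\<^esub> g \<otimes>\<^bsub>FA\<^esub> h = f \<otimes>\<^bsub>FA\<^esub> (g \<otimes>\<^bsub>FA\<^esub> h)"
      using f g h by (intro ext free_mult_assoc) (auto simp: free_carrierD)
  qed
qed (intro ext; simp add: free_algebra_simps(3) free_mult_distr free_carrierD)+

lemma free_smult_closed:
  assumes c: "c \<in> carrier K" and f: "f \<in> carrier FA"
  shows "c \<odot>\<^bsub>FA\<^esub> f \<in> carrier FA"
  unfolding free_algebra_simps
proof (rule free_carrierI[where S = "{w. f w \<noteq> \<zero>}"])
  fix w
  show "c \<otimes> f w \<in> carrier K"
    using c f by (simp add: free_carrierD(1))
  assume "c \<otimes> f w \<noteq> \<zero>"
  hence "f w \<noteq> \<zero>"
    using c by auto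
  thus "w \<in> {w. f w \<noteq> \<zero>} \<and> set w \<subseteq> V"
    using free_carrierD(3)[OF f] by auto
qed (use f in \<open>simp add: free_carrierD(2)\<close>)

lemma free_component_carrier: "component FA n \<subseteq> carrier FA"
  by (auto simp: free_algebra_def)

lemma free_componentI:
  "\<lbrakk>f \<in> carrier FA; \<And>w. f w \<noteq> \<zero> \<Longrightarrow> length w = n\<rbrakk> \<Longrightarrow> f \<in> component FA n"
  by (simp add: free_algebra_def)

lemma letter_component: "v \<in> V \<Longrightarrow> letter K v \<in> component FA 1"
  by (intro free_componentI free_carrierI[where S = "{[v]}"]) (auto simp: letter_def split: if_splits)

text \<open>Induction on a finite set containing the support, removing one monomial at a time: the
  monomial on \<open>v # u\<close> is \<open>letter K v\<close> times the monomial \<open>t\<close>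
  on \<open>u\<close> with the same coefficient, and \<open>g\<close> is the rest.\<close>

lemma free_component_generated:
  "component FA (Suc n) \<subseteq> component FA 1 \<cdot>\<^bsub>FA\<^esub> component FA n"
proof
  interpret FA: ring FA
    by (rule free_algebra_ring)
  fix f assume "f \<in> component FA (Suc n)"
  moreover have "finite S \<Longrightarrow> f \<in> component FA (Suc n) \<Longrightarrow> {w. f w \<noteq> \<zero>} \<subseteq> S \<Longrightarrow>
    f \<in> component FA 1 \<cdot>\<^bsub>FA\<^esub> component FA n" for S f
  proof (induction S arbitrary: f rule: finite_induct)
    case empty
    hence "f = \<zero>\<^bsub>FA\<^esub>"
      by (auto simp: free_algebra_simps)
    \<comment> \<open>\<open>ideal_prod\<close> is built from products and sums only, so zero has to
      be exhibited as a product.\<close>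
    hence "f = \<zero>\<^bsub>FA\<^esub> \<otimes>\<^bsub>FA\<^esub> \<zero>\<^bsub>FA\<^esub>"
      by simp
    moreover have "\<zero>\<^bsub>FA\<^esub> \<in> component FA m" for m
      using FA.zero_closed by (simp add: free_algebra_def)
    ultimately show ?case
      by (metis ideal_prod.prod)
  next
    case (insert x S)
    have f: "f \<in> carrier FA"
      using insert.prems free_component_carrier by blast
    have len: "f w \<noteq> \<zero> \<Longrightarrow> length w = Suc n" for w
      using insert.prems by (simp add: free_algebra_def)
    show ?case
    proof (cases "f x = \<zero>")
      case True
      thus ?thesis
        using insert by (intro insert.IH) auto
    next
      case False
      then obtain v u where x: "x = v # u" "length u = n"
        using len[OF False] by (auto simp: length_Suc_conv)
      have vu: "v \<in> V" "set u \<subseteq> V"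
        using free_carrierD(3)[OF f False] x by auto
      define t where "t w = (if w = u then f x else \<zero>)" for w
      define g where "g w = (if w = x then \<zero> else f w)" for w
      have t: "t \<in> component FA n"
        using x vu free_carrierD(1)[OF f]
        by (intro free_componentI free_carrierI[where S = "{u}"]) (auto simp: t_def split: if_splits)
      have g: "g \<in> component FA (Suc n)"
      proof (intro free_componentI free_carrierI[where S = "{w. f w \<noteq> \<zero>}"])
        show "g w \<in> carrier K" for w
          using free_carrierD(1)[OF f] by (simp add: g_def)
      qed (use free_carrierD(2,3)[OF f] len in \<open>auto simp: g_def split: if_splits\<close>)
      have l: "letter K v w \<in> carrier K" for w
        by (simp add: letter_def)
      have tK: "t w \<in> carrier K" for w
        using free_carrierD(1)[OF f] by (simp add: t_def)
      have zero: "((\<lambda>w. \<zero>) \<otimes>\<^bsub>FA\<^esub> t) w = \<zero>" for w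
        using tK by (simp add: free_mult_eval)
      \<comment> \<open>Stripping the first letter turns \<open>letter K v\<close> into the unit or
        into zero, so the recursion for the product stops after one step.\<close>
      have lone: "(\<lambda>w. letter K v (v' # w)) = (if v' = v then \<one>\<^bsub>FA\<^esub> else (\<lambda>w. \<zero>))" for v'
        by (auto simp: letter_def free_algebra_simps)
      have "(letter K v \<otimes>\<^bsub>FA\<^esub> t) w = (if w = x then f x else \<zero>)" for w
      proof (cases w)
        case Nil
        thus ?thesis
          using l tK x by (simp add: free_mult_Nil) (simp add: letter_def)
      next
        case (Cons v' w')
        have "letter K v [] = \<zero>"
          by (simp add: letter_def)
        thus ?thesis
          using l tK x zero by (simp add: Cons free_mult_Cons lone free_one_mult) (simp add: t_def)
      qed
      hence "f = letter K v \<otimes>\<^bsub>FA\<^esub> t \<oplus>\<^bsub>FA\<^esub> g"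
        using free_carrierD(1)[OF f] by (auto simp: free_algebra_simps(3) g_def)
      moreover have "g \<in> component FA 1 \<cdot>\<^bsub>FA\<^esub> component FA n"
        using insert.prems by (intro insert.IH g) (auto simp: g_def)
      ultimately show ?thesis
        using letter_component[OF vu(1)] t by (auto intro!: ideal_prod.intros)
    qed
  qed
  ultimately show "f \<in> component FA 1 \<cdot>\<^bsub>FA\<^esub> component FA n"
    using free_carrierD(2) free_component_carrier by blast
qed

end

text \<open>Generation in degree 1 is inherited from the free algebra along three maps: onto the
  tensor algebra, onto its quotient by \<open>\<Omega>\<close>, and from there to
  \<open>A\<close>.\<close>

lemma quadratic_algebra_generated:
  assumes "quadratic_algebra K A"
  shows "component A (Suc n) \<subseteq> component A 1 \<cdot>\<^bsub>A\<^esub> component A n"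
proof -
  let ?V = "component A 1" and ?M = "A\<lparr>carrier := component A 1\<rparr>"
  let ?T = "tensor_algebra K ?M" and ?F = "free_algebra K ?V"
  have gA: "graded_algebra K A"
    using assms by (simp add: quadratic_algebra_def)
  hence K: "field K" and A: "ring A" and mod: "Module.module K A"
    and sub: "\<And>n. submodule (component A n) K A"
    by (simp_all add: graded_algebra_def)
  interpret A: ring A by fact
  interpret M: module K A by fact
  interpret free_algebra_over K ?V
    using K by (simp add: free_algebra_over_def)
  interpret FA: ring ?F
    by (rule free_algebra_ring)
  let ?L = "linearity_relations K ?M"
  have letter: "letter K v \<in> carrier ?F" if "v \<in> ?V" for v
    using letter_component[OF that] free_component_carrier by blast
  have "?L \<subseteq> carrier ?F"
    using M.submoduleE(4,5)[OF sub]
    by (auto simp: linearity_relations_def Let_def simp del: One_nat_def intro!: FA.minus_closed FA.a_closed free_smult_closed letter)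
  hence L: "ideal (Idl\<^bsub>?F\<^esub> ?L) ?F"
    by (rule FA.genideal_ideal)
  have T: "?T = quotient_algebra ?F (Idl\<^bsub>?F\<^esub> ?L)"
    by (simp add: tensor_algebra_def)
  interpret T: ring ?T
    unfolding T using L by (rule quotient_algebra_ring)
  have Tgen: "component ?T (Suc n) \<subseteq> component ?T 1 \<cdot>\<^bsub>?T\<^esub> component ?T n"
    unfolding T
    by (rule component_generated_image[OF quotient_algebra_hom[OF L] free_algebra_ring])
      (use free_component_carrier free_component_generated in \<open>auto simp: quotient_algebra_component\<close>)
  have Tcar: "component ?T k \<subseteq> carrier ?T" for k
    using free_component_carrier ring_hom_closed[OF quotient_algebra_hom[OF L]]
    unfolding T quotient_algebra_component by blast
  obtain \<Omega> \<phi> where \<Omega>: "\<Omega> \<subseteq> component ?T 2" and \<phi>: "\<phi> \<in> graded_iso K A (quotient_algebra ?T (Idl\<^bsub>?T\<^esub> \<Omega>))"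
    using assms unfolding quadratic_algebra_def Let_def by blast
  let ?Q = "quotient_algebra ?T (Idl\<^bsub>?T\<^esub> \<Omega>)"
  have I: "ideal (Idl\<^bsub>?T\<^esub> \<Omega>) ?T"
    using \<Omega> Tcar by (intro T.genideal_ideal) blast
  have Qgen: "component ?Q (Suc n) \<subseteq> component ?Q 1 \<cdot>\<^bsub>?Q\<^esub> component ?Q n"
    by (rule component_generated_image[OF quotient_algebra_hom[OF I] T.ring_axioms])
      (use Tcar Tgen in \<open>auto simp: quotient_algebra_component\<close>)
  have Qcar: "component ?Q k \<subseteq> carrier ?Q" for k
    using Tcar ring_hom_closed[OF quotient_algebra_hom[OF I]]
    unfolding quotient_algebra_component by blast
  have iso: "\<phi> \<in> ring_iso A ?Q" and comp: "\<And>k. \<phi> ` component A k = component ?Q k"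
    using \<phi> by (simp_all add: graded_iso_def)
  \<comment> \<open>The isomorphism given by quadraticity starts at \<open>A\<close>; transport of
    generation needs its inverse.\<close>
  let ?\<psi> = "inv_into (carrier A) \<phi>"
  have \<psi>: "?\<psi> \<in> ring_hom ?Q A"
    using ring_iso_set_sym[OF A iso] by (simp add: ring_iso_def)
  have inj: "inj_on \<phi> (carrier A)"
    using iso by (simp add: ring_iso_def bij_betw_def)
  have "?\<psi> ` component ?Q k = component A k" for k
    unfolding comp[symmetric] using M.submoduleE(1)[OF sub] by (intro inv_into_image_cancel[OF inj])
  thus ?thesis
    using component_generated_image[OF \<psi> quotient_algebra_ring[OF I] Qcar Qcar _ Qgen] by blast
qed

section \<open>Cup products on free pro-\<open>p\<close> groups\<close>

text \<open>Two linear equations in three unknowns: the cross product of the coefficient vectors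
  solves both and is nonzero unless the vectors are proportional.\<close>

lemma (in field) exists_orthogonal:
  assumes "a1 \<in> carrier R" "a2 \<in> carrier R" "a3 \<in> carrier R"
    and "b1 \<in> carrier R" "b2 \<in> carrier R" "b3 \<in> carrier R"
  obtains \<alpha> \<beta> \<gamma> where "\<alpha> \<in> carrier R" "\<beta> \<in> carrier R" "\<gamma> \<in> carrier R"
    "\<alpha> \<noteq> \<zero> \<or> \<beta> \<noteq> \<zero> \<or> \<gamma> \<noteq> \<zero>"
    "\<alpha> \<otimes> a1 \<oplus> \<beta> \<otimes> a2 \<oplus> \<gamma> \<otimes> a3 = \<zero>" "\<alpha> \<otimes> b1 \<oplus> \<beta> \<otimes> b2 \<oplus> \<gamma> \<otimes> b3 = \<zero>"
proof -
  define c where "c = (a2 \<otimes> b3 \<ominus> a3 \<otimes> b2, a3 \<otimes> b1 \<ominus> a1 \<otimes> b3, a1 \<otimes> b2 \<ominus> a2 \<otimes> b1)"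
  show thesis
  proof (cases "c = (\<zero>, \<zero>, \<zero>)")
    case False
    show thesis
    proof (rule that)
      show "fst c \<noteq> \<zero> \<or> fst (snd c) \<noteq> \<zero> \<or> snd (snd c) \<noteq> \<zero>"
        using False by (metis prod.collapse)
      show "fst c \<otimes> a1 \<oplus> fst (snd c) \<otimes> a2 \<oplus> snd (snd c) \<otimes> a3 = \<zero>"
        "fst c \<otimes> b1 \<oplus> fst (snd c) \<otimes> b2 \<oplus> snd (snd c) \<otimes> b3 = \<zero>"
        unfolding c_def fst_conv snd_conv using assms by algebra+
    qed (use assms in \<open>simp_all add: c_def\<close>)
  next
    case True
    \<comment> \<open>All minors vanish, so a vector such as
      \<open>(\<ominus> a2, a1, \<zero>)\<close>, visibly orthogonal to the first row, is orthogonal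
      to the second as well. Some vector of this kind is nonzero unless both rows are zero.\<close>
    hence eq: "a2 \<otimes> b3 = a3 \<otimes> b2" "a3 \<otimes> b1 = a1 \<otimes> b3" "a1 \<otimes> b2 = a2 \<otimes> b1"
      using assms by (simp_all add: c_def)
    have r: "\<ominus> x \<otimes> y \<oplus> z \<otimes> w = \<zero>"
      if "x \<in> carrier R" "y \<in> carrier R" "z \<in> carrier R" "w \<in> carrier R" "x \<otimes> y = z \<otimes> w" for x y z w
      using that by (simp add: l_minus l_neg)
    consider "a1 \<noteq> \<zero> \<or> a2 \<noteq> \<zero>" | "b1 \<noteq> \<zero> \<or> b2 \<noteq> \<zero>" | "a2 \<noteq> \<zero> \<or> a3 \<noteq> \<zero>" | "b2 \<noteq> \<zero> \<or> b3 \<noteq> \<zero>"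
      | "a1 = \<zero>" "a2 = \<zero>" "a3 = \<zero>" "b1 = \<zero>" "b2 = \<zero>" "b3 = \<zero>"
      by blast
    thus thesis
    proof cases
      case 1
      show thesis
        by (rule that[of "\<ominus> a2" a1 \<zero>])
          (use 1 assms r[OF _ _ _ _ m_comm, of a2 a1] r[of a2 b1 a1 b2] eq(3) in \<open>simp_all, blast?\<close>)
    next
      case 2
      show thesis
        by (rule that[of "\<ominus> b2" b1 \<zero>])
          (use 2 assms r[OF _ _ _ _ m_comm, of b2 b1] r[of b2 a1 b1 a2] eq(3) m_comm[of b2 a1] m_comm[of b1 a2] in \<open>simp_all, blast?\<close>)
    next
      case 3
      show thesis
        by (rule that[of \<zero> "\<ominus> a3" a2])
          (use 3 assms r[OF _ _ _ _ m_comm, of a3 a2] r[of a3 b2 a2 b3] eq(1) in \<open>simp_all, blast?\<close>)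
    next
      case 4
      show thesis
        by (rule that[of \<zero> "\<ominus> b3" b2])
          (use 4 assms r[OF _ _ _ _ m_comm, of b3 b2] r[of b3 a2 b2 a3] eq(1) m_comm[of b3 a2] m_comm[of b2 a3] in \<open>simp_all, blast?\<close>)
    next
      case 5
      show thesis
        by (rule that[of \<one> \<zero> \<zero>]) (use 5 in auto)
    qed
  qed
qed

lemma finite_pro_p_group:
  assumes "group H" "prime p" "card (carrier H) = p ^ n"
  shows "pro_p_group p H (discrete_topology (carrier H))"
proof -
  interpret group H by fact
  \<comment> \<open>A positive \<open>card\<close> implies finiteness, as infinite sets have
    \<open>card\<close> equal to 0.\<close>
  have fin: "finite (carrier H)"
    using assms(2,3) by (metis card_gt_0_iff prime_gt_0_nat zero_less_power)
  show ?thesis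
  proof
    show "continuous_map (prod_topology (discrete_topology (carrier H)) (discrete_topology (carrier H)))
        (discrete_topology (carrier H)) (\<lambda>(x, y). x \<otimes>\<^bsub>H\<^esub> y)"
      by (auto simp: prod_topology_discrete_topology[symmetric])
    show "\<exists>k. card (rcosets\<^bsub>H\<^esub> N) = p ^ k" if "N \<lhd> H" for N
    proof -
      have "card (rcosets\<^bsub>H\<^esub> N) * card N = p ^ n"
        using lagrange_finite[OF fin normal_imp_subgroup[OF that]] assms(3) by (simp add: order_def)
      hence "card (rcosets\<^bsub>H\<^esub> N) dvd p ^ n"
        by (metis dvd_triv_left)
      thus ?thesis
        using divides_primepow_nat[OF assms(2)] by blast
    qed
  qed (use fin in \<open>auto simp: connectedin_discrete_topology compact_space_discrete_topology\<close>)
qed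

text \<open>The group of upper unitriangular \<open>3 \<times> 3\<close> matrices, encoded on the type of the target groups
  in \<^const>\<open>free_pro_p\<close>. The triple \<open>(a, b, c)\<close> has \<open>a, b\<close> above the diagonal and \<open>c\<close> in the
  corner.\<close>

definition encode :: "'k::countable \<times> 'k \<times> 'k \<Rightarrow> nat set" where
  "encode x = {to_nat x}"

definition decode :: "nat set \<Rightarrow> 'k::countable \<times> 'k \<times> 'k" where
  "decode X = from_nat (the_elem X)"

lemma decode_encode [simp]: "decode (encode x) = x"
  by (simp add: encode_def decode_def)

lemma encode_inject [simp]: "encode x = encode y \<longleftrightarrow> x = y"
  by (metis decode_encode)

definition unitriangular_mult ::
    "('k, 'n) ring_scheme \<Rightarrow> 'k \<times> 'k \<times> 'k \<Rightarrow> 'k \<times> 'k \<times> 'k \<Rightarrow> 'k \<times> 'k \<times> 'k" where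
  "unitriangular_mult K = (\<lambda>(a, b, c) (a', b', c').
     (a \<oplus>\<^bsub>K\<^esub> a', b \<oplus>\<^bsub>K\<^esub> b', c \<oplus>\<^bsub>K\<^esub> c' \<oplus>\<^bsub>K\<^esub> a \<otimes>\<^bsub>K\<^esub> b'))"

definition unitriangular :: "('k::countable, 'n) ring_scheme \<Rightarrow> nat set monoid" where
  "unitriangular K =
    \<lparr>carrier = encode ` (carrier K \<times> carrier K \<times> carrier K),
     monoid.mult = (\<lambda>X Y. encode (unitriangular_mult K (decode X) (decode Y))),
     one = encode (\<zero>\<^bsub>K\<^esub>, \<zero>\<^bsub>K\<^esub>, \<zero>\<^bsub>K\<^esub>)\<rparr>"

lemma unitriangular_simps [simp]:
  "encode x \<in> carrier (unitriangular K) \<longleftrightarrow> x \<in> carrier K \<times> carrier K \<times> carrier K"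
  "encode x \<otimes>\<^bsub>unitriangular K\<^esub> encode y = encode (unitriangular_mult K x y)"
  "\<one>\<^bsub>unitriangular K\<^esub> = encode (\<zero>\<^bsub>K\<^esub>, \<zero>\<^bsub>K\<^esub>, \<zero>\<^bsub>K\<^esub>)"
  by (auto simp: unitriangular_def)

lemma unitriangularE:
  assumes "X \<in> carrier (unitriangular K)"
  obtains a b c where "X = encode (a, b, c)" "a \<in> carrier K" "b \<in> carrier K" "c \<in> carrier K"
  using assms by (auto simp: unitriangular_def)

text \<open>Countability of the scalar type is what allows \<open>encode\<close> to realize triples
  of scalars on the target type of \<open>free_pro_p\<close>.\<close>

locale countable_field = field R for R :: "('k::countable, 'n) ring_scheme" (structure)
begin

lemma unitriangular_group: "group (unitriangular R)"
proof (rule groupI)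
  fix X Y Z assume "X \<in> carrier (unitriangular R)" "Y \<in> carrier (unitriangular R)" "Z \<in> carrier (unitriangular R)"
  then obtain a b c a' b' c' a'' b'' c'' where e: "X = encode (a, b, c)" "a \<in> carrier R" "b \<in> carrier R" "c \<in> carrier R"
    "Y = encode (a', b', c')" "a' \<in> carrier R" "b' \<in> carrier R" "c' \<in> carrier R"
    "Z = encode (a'', b'', c'')" "a'' \<in> carrier R" "b'' \<in> carrier R" "c'' \<in> carrier R"
    by (metis unitriangularE)
  show "X \<otimes>\<^bsub>unitriangular R\<^esub> Y \<otimes>\<^bsub>unitriangular R\<^esub> Z = X \<otimes>\<^bsub>unitriangular R\<^esub> (Y \<otimes>\<^bsub>unitriangular R\<^esub> Z)"
    using e by (simp add: unitriangular_mult_def) algebra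
next
  fix X assume "X \<in> carrier (unitriangular R)"
  then obtain a b c where e: "X = encode (a, b, c)" "a \<in> carrier R" "b \<in> carrier R" "c \<in> carrier R"
    by (rule unitriangularE)
  \<comment> \<open>The inverse matrix; the term \<open>a \<otimes> b\<close> in its corner cancels
    the mixed term of the multiplication.\<close>
  have "encode (\<ominus> a, \<ominus> b, a \<otimes> b \<ominus> c) \<otimes>\<^bsub>unitriangular R\<^esub> X = \<one>\<^bsub>unitriangular R\<^esub>"
    using e by (simp add: unitriangular_mult_def l_neg) algebra
  moreover have "encode (\<ominus> a, \<ominus> b, a \<otimes> b \<ominus> c) \<in> carrier (unitriangular R)"
    using e by simp
  ultimately show "\<exists>Y\<in>carrier (unitriangular R). Y \<otimes>\<^bsub>unitriangular R\<^esub> X = \<one>\<^bsub>unitriangular R\<^esub>"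
    by blast
qed (auto elim!: unitriangularE simp: unitriangular_mult_def)

lemma card_unitriangular: "card (carrier (unitriangular R)) = card (carrier R) ^ 3"
proof -
  have "inj_on encode (carrier R \<times> carrier R \<times> carrier R)"
    by (simp add: inj_on_def)
  thus ?thesis
    by (simp add: unitriangular_def card_image card_cartesian_product power3_eq_cube)
qed

text \<open>Lifting \<open>(\<mu>, \<nu>)\<close> from the basis to the unitriangular group makes the cup product of
  \<open>\<mu>\<close> and \<open>\<nu>\<close> a coboundary on the free group; that the lift agrees with \<open>(\<mu>, \<nu>)\<close> on the whole
  group is the uniqueness part of the universal property, applied to \<open>x \<mapsto> (\<mu> x, 0, 0)\<close> and
  \<open>x \<mapsto> (\<nu> x, 0, 0)\<close>.\<close>

lemma free_pro_p_cup_splits: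
  fixes F :: "('f, 'm) monoid_scheme"
  assumes "prime p" "card (carrier R) = p" "free_pro_p p F TF X"
    and "continuous_map TF (discrete_topology (carrier R)) \<mu>"
    and "continuous_map TF (discrete_topology (carrier R)) \<nu>"
    and \<mu>: "\<And>f g. \<lbrakk>f \<in> carrier F; g \<in> carrier F\<rbrakk> \<Longrightarrow> \<mu> (f \<otimes>\<^bsub>F\<^esub> g) = \<mu> f \<oplus> \<mu> g"
    and \<nu>: "\<And>f g. \<lbrakk>f \<in> carrier F; g \<in> carrier F\<rbrakk> \<Longrightarrow> \<nu> (f \<otimes>\<^bsub>F\<^esub> g) = \<nu> f \<oplus> \<nu> g"
  shows "\<exists>u. continuous_map TF (discrete_topology (carrier R)) u \<and>
    (\<forall>f\<in>carrier F. \<forall>g\<in>carrier F. u (f \<otimes>\<^bsub>F\<^esub> g) = u f \<oplus> u g \<oplus> \<mu> f \<otimes> \<nu> g)"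
proof -
  let ?E = "unitriangular R" and ?D = "discrete_topology (carrier R)"
  let ?TE = "discrete_topology (carrier (unitriangular R))"
  interpret E: group ?E by (rule unitriangular_group)
  have E: "pro_p_group p ?E ?TE"
    using assms(1,2) E.group_axioms card_unitriangular by (intro finite_pro_p_group[where n = 3]) simp_all
  interpret F: pro_p_group p F TF
    using assms(3) by (simp add: free_pro_p_def)
  note fp = assms(3)[unfolded free_pro_p_def]
  have X: "X \<subseteq> carrier F" and conv: "converges_to_one F TF X (\<lambda>x. x)"
    using fp by simp_all
  have univ: "\<And>g. \<lbrakk>g \<in> X \<rightarrow> carrier ?E; converges_to_one ?E ?TE X g\<rbrakk> \<Longrightarrow>
        \<exists>h. h \<in> hom F ?E \<and> continuous_map TF ?TE h \<and> (\<forall>x\<in>X. h x = g x) \<and>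
             (\<forall>h'. h' \<in> hom F ?E \<and> continuous_map TF ?TE h' \<and> (\<forall>x\<in>X. h' x = g x) \<longrightarrow>
                   (\<forall>y\<in>carrier F. h' y = h y))"
    by (rule fp[THEN conjunct2, THEN conjunct2, THEN conjunct2, rule_format]) (use E in simp)
  have lift: "\<exists>h. h \<in> hom F ?E \<and> continuous_map TF ?TE h \<and> (\<forall>x\<in>X. h x = g x)"
    if "g \<in> X \<rightarrow> carrier ?E" "converges_to_one ?E ?TE X g" for g
    using univ[OF that] by (elim exE conjE) (intro exI conjI)
  have unique: "h f = h' f"
    if "g \<in> X \<rightarrow> carrier ?E" "converges_to_one ?E ?TE X g"
      "h \<in> hom F ?E" "continuous_map TF ?TE h" "\<forall>x\<in>X. h x = g x"
      "h' \<in> hom F ?E" "continuous_map TF ?TE h'" "\<forall>x\<in>X. h' x = g x" "f \<in> carrier F" for g h h' f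
    using univ[OF that(1,2)]
  proof (elim exE conjE)
    fix k assume k: "\<forall>h'. h' \<in> hom F ?E \<and> continuous_map TF ?TE h' \<and> (\<forall>x\<in>X. h' x = g x) \<longrightarrow>
        (\<forall>y\<in>carrier F. h' y = k y)"
    show "h f = h' f"
      using k[rule_format, OF conjI[OF that(3) conjI[OF that(4,5)]] that(9)]
        k[rule_format, OF conjI[OF that(6) conjI[OF that(7,8)]] that(9)] by simp
  qed
  have car: "\<omega> f \<in> carrier R" if "continuous_map TF ?D \<omega>" "f \<in> carrier F" for \<omega> f
    using continuous_map_image_subset_topspace[OF that(1)] that(2) F.topspace_eq by auto
  have one: "\<omega> \<one>\<^bsub>F\<^esub> = \<zero>" if "continuous_map TF ?D \<omega>"
    "\<And>f g. \<lbrakk>f \<in> carrier F; g \<in> carrier F\<rbrakk> \<Longrightarrow> \<omega> (f \<otimes>\<^bsub>F\<^esub> g) = \<omega> f \<oplus> \<omega> g" for \<omega>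
    using that(2)[of "\<one>\<^bsub>F\<^esub>" "\<one>\<^bsub>F\<^esub>"] car[OF that(1), of "\<one>\<^bsub>F\<^esub>"] by simp
  have conv_pair: "converges_to_one ?E ?TE X (\<lambda>x. encode (\<omega> x, \<omega>' x, \<zero>))"
    if \<omega>: "continuous_map TF ?D \<omega>" "\<omega> \<one>\<^bsub>F\<^esub> = \<zero>" and \<omega>': "continuous_map TF ?D \<omega>'" "\<omega>' \<one>\<^bsub>F\<^esub> = \<zero>"
    for \<omega> \<omega>'
    unfolding converges_to_one_def
  proof (intro allI impI, elim conjE)
    fix U assume U: "\<one>\<^bsub>?E\<^esub> \<in> U"
    \<comment> \<open>The common zero set of both maps is an open neighbourhood of 1. It contains
      all but finitely many basis elements, and these are sent to the unit.\<close>
    define V where "V = {f \<in> topspace TF. \<omega> f \<in> {\<zero>}} \<inter> {f \<in> topspace TF. \<omega>' f \<in> {\<zero>}}"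
    have "openin TF V"
      unfolding V_def by (intro openin_Int openin_continuous_map_preimage[OF \<omega>(1)]
          openin_continuous_map_preimage[OF \<omega>'(1)]) auto
    moreover have "\<one>\<^bsub>F\<^esub> \<in> V"
      using \<omega> \<omega>' F.topspace_eq by (simp add: V_def)
    ultimately have "finite {x \<in> X. x \<notin> V}"
      using conv by (simp add: converges_to_one_def)
    moreover have "{x \<in> X. encode (\<omega> x, \<omega>' x, \<zero>) \<notin> U} \<subseteq> {x \<in> X. x \<notin> V}"
      using U by (auto simp: V_def)
    ultimately show "finite {x \<in> X. encode (\<omega> x, \<omega>' x, \<zero>) \<notin> U}"
      by (rule finite_subset[rotated])
  qed
  \<comment> \<open>Zero is the simplest corner entry on the basis that keeps the map convergent to
    1.\<close>
  have "(\<lambda>x. encode (\<mu> x, \<nu> x, \<zero>)) \<in> X \<rightarrow> carrier ?E"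
    using car[OF assms(4)] car[OF assms(5)] X by (simp add: Pi_def subset_iff)
  moreover have "converges_to_one ?E ?TE X (\<lambda>x. encode (\<mu> x, \<nu> x, \<zero>))"
    using one[OF assms(4) \<mu>] one[OF assms(5) \<nu>] by (intro conv_pair assms(4,5))
  ultimately have "\<exists>h. h \<in> hom F ?E \<and> continuous_map TF ?TE h \<and> (\<forall>x\<in>X. h x = encode (\<mu> x, \<nu> x, \<zero>))"
    by (rule lift)
  then obtain h where h: "h \<in> hom F ?E" "continuous_map TF ?TE h"
      and hX: "\<forall>x\<in>X. h x = encode (\<mu> x, \<nu> x, \<zero>)"
    by (elim exE conjE)
  \<comment> \<open>The matrix entries of the lift. The corner entry \<open>t 2\<close> is the
    required \<open>u\<close>; its deviation from additivity is
    \<open>t 0 f \<otimes> t 1 g\<close>.\<close>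
  define t :: "nat \<Rightarrow> 'f \<Rightarrow> 'k" where "t i f = (case decode (h f) of (a, b, c) \<Rightarrow> if i = 0 then a else if i = 1 then b else c)" for i f
  have hE: "h f \<in> carrier ?E" if "f \<in> carrier F" for f
    using h(1) that by (auto simp: hom_def)
  have ht: "h f = encode (t 0 f, t 1 f, t 2 f)" "t i f \<in> carrier R" if "f \<in> carrier F" for f i
    by (rule unitriangularE[OF hE[OF that]]; simp add: t_def)+
  have t_mult: "t 0 (f \<otimes>\<^bsub>F\<^esub> g) = t 0 f \<oplus> t 0 g" "t 1 (f \<otimes>\<^bsub>F\<^esub> g) = t 1 f \<oplus> t 1 g"
      "t 2 (f \<otimes>\<^bsub>F\<^esub> g) = t 2 f \<oplus> t 2 g \<oplus> t 0 f \<otimes> t 1 g"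
    if "f \<in> carrier F" "g \<in> carrier F" for f g
  proof -
    have "h (f \<otimes>\<^bsub>F\<^esub> g) = h f \<otimes>\<^bsub>?E\<^esub> h g"
      using h(1) that by (simp add: hom_def)
    thus "t 0 (f \<otimes>\<^bsub>F\<^esub> g) = t 0 f \<oplus> t 0 g" "t 1 (f \<otimes>\<^bsub>F\<^esub> g) = t 1 f \<oplus> t 1 g"
      "t 2 (f \<otimes>\<^bsub>F\<^esub> g) = t 2 f \<oplus> t 2 g \<oplus> t 0 f \<otimes> t 1 g"
      using that by (simp_all add: ht(1) unitriangular_mult_def)
  qed
  have t_cont: "continuous_map TF ?D (t i)" for i
  proof -
    have "continuous_map ?TE ?D (\<lambda>x. case decode x of (a :: 'k, b, c) \<Rightarrow> if i = 0 then a else if i = 1 then b else c)"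
      by (auto simp: unitriangular_def)
    from continuous_map_compose[OF h(2) this] show ?thesis
      by (simp add: o_def t_def[abs_def])
  qed
  have agree: "\<omega> f = \<tau> f"
    if \<omega>: "continuous_map TF ?D \<omega>" "\<And>f g. \<lbrakk>f \<in> carrier F; g \<in> carrier F\<rbrakk> \<Longrightarrow> \<omega> (f \<otimes>\<^bsub>F\<^esub> g) = \<omega> f \<oplus> \<omega> g"
      and \<tau>: "continuous_map TF ?D \<tau>" "\<And>f g. \<lbrakk>f \<in> carrier F; g \<in> carrier F\<rbrakk> \<Longrightarrow> \<tau> (f \<otimes>\<^bsub>F\<^esub> g) = \<tau> f \<oplus> \<tau> g"
      and X': "\<And>x. x \<in> X \<Longrightarrow> \<omega> x = \<tau> x" and f: "f \<in> carrier F" for \<omega> \<tau> f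
  proof -
    let ?g = "\<lambda>\<omega> f. encode (\<omega> f, \<zero>, \<zero>)"
    have hom: "?g \<sigma> \<in> hom F ?E" "continuous_map TF ?TE (?g \<sigma>)"
      if "continuous_map TF ?D \<sigma>" "\<And>f g. \<lbrakk>f \<in> carrier F; g \<in> carrier F\<rbrakk> \<Longrightarrow> \<sigma> (f \<otimes>\<^bsub>F\<^esub> g) = \<sigma> f \<oplus> \<sigma> g" for \<sigma>
    proof -
      show "?g \<sigma> \<in> hom F ?E"
        using that car[OF that(1)] by (auto simp: hom_def unitriangular_mult_def)
      have "continuous_map ?D ?TE (\<lambda>a. encode (a, \<zero>, \<zero>))"
        by simp
      from continuous_map_compose[OF that(1) this] show "continuous_map TF ?TE (?g \<sigma>)"
        by (simp add: o_def)
    qed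
    have "continuous_map TF ?D (\<lambda>_. \<zero>)"
      by simp
    hence c: "converges_to_one ?E ?TE X (?g \<omega>)"
      using conv_pair[of \<omega> "\<lambda>_. \<zero>"] \<omega> one[OF \<omega>] by simp
    have "?g \<omega> \<in> X \<rightarrow> carrier ?E"
      using car[OF \<omega>(1)] X by auto
    from this c have "?g \<omega> f = ?g \<tau> f"
      by (rule unique[where h = "?g \<omega>" and h' = "?g \<tau>"]) (use hom[OF \<omega>] hom[OF \<tau>] X' f in simp_all)
    thus ?thesis by simp
  qed
  have t01: "t 0 x = \<mu> x" "t 1 x = \<nu> x" if "x \<in> X" for x
    using bspec[OF hX that] by (simp_all add: t_def)
  have \<mu>': "t 0 f = \<mu> f" if "f \<in> carrier F" for f
    by (rule agree[OF t_cont t_mult(1) assms(4) \<mu> t01(1) that])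
  have \<nu>': "t 1 f = \<nu> f" if "f \<in> carrier F" for f
    by (rule agree[OF t_cont t_mult(2) assms(5) \<nu> t01(2) that])
  have "t 2 (f \<otimes>\<^bsub>F\<^esub> g) = t 2 f \<oplus> t 2 g \<oplus> \<mu> f \<otimes> \<nu> g" if "f \<in> carrier F" "g \<in> carrier F" for f g
    using t_mult(3)[OF that] \<mu>'[OF that(1)] \<nu>'[OF that(2)] by simp
  thus ?thesis
    using t_cont[of 2] by blast
qed

end

section \<open>Descent along a presentation\<close>

text \<open>Composing the projection to \<open>F Mod R\<close> with the isomorphism condenses the
  presentation to one topological quotient map whose fibres are the cosets of
  \<open>R\<close>.\<close>

lemma minimal_presentationE:
  assumes "minimal_presentation p F TF R G T"
  obtains X \<pi> where "free_pro_p p F TF X" "R \<lhd> F" "closedin TF R" "quotient_map TF T \<pi>" "\<pi> \<in> hom F G"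
    "\<forall>f\<in>carrier F. \<forall>g\<in>carrier F. \<pi> f = \<pi> g \<longleftrightarrow> R #>\<^bsub>F\<^esub> f = R #>\<^bsub>F\<^esub> g"
proof -
  obtain X TQ \<phi> where X: "free_pro_p p F TF X" and R: "R \<lhd> F" "closedin TF R"
    and q: "quotient_map TF TQ (\<lambda>x. R #>\<^bsub>F\<^esub> x)" and \<phi>: "\<phi> \<in> iso (F Mod R) G" "homeomorphic_map TQ T \<phi>"
    using assms unfolding minimal_presentation_def by blast
  let ?\<pi> = "\<phi> \<circ> (\<lambda>x. R #>\<^bsub>F\<^esub> x)"
  have "quotient_map TF T ?\<pi>"
    by (rule quotient_map_compose[OF q]) (use \<phi>(2) in \<open>simp only: homeomorphic_map_def\<close>)
  moreover have "?\<pi> \<in> hom F G"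
    using normal.r_coset_hom_Mod[OF R(1)] \<phi>(1) by (intro hom_compose) (auto simp: iso_def)
  moreover have "?\<pi> f = ?\<pi> g \<longleftrightarrow> R #>\<^bsub>F\<^esub> f = R #>\<^bsub>F\<^esub> g" if "f \<in> carrier F" "g \<in> carrier F" for f g
  proof -
    have "inj_on \<phi> (carrier (F Mod R))"
      using \<phi>(1) by (simp add: iso_def bij_betw_def)
    thus ?thesis
      using that by (auto simp: carrier_FactGroup dest: inj_onD)
  qed
  ultimately show thesis
    using that X R by blast
qed

locale presented_group = countable_field K
  for K :: "('k::countable, 'n) ring_scheme" (structure) +
  fixes p :: nat and G :: "('a, 'm) monoid_scheme" and T :: "'a topology"
    and F :: "('f, 'l) monoid_scheme" and TF :: "'f topology" and R :: "'f set" and X :: "'f set"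
    and \<pi> :: "'f \<Rightarrow> 'a"
  assumes prime: "prime p" and card_K: "card (carrier K) = p"
    and G: "pro_p_group p G T"
    and free: "free_pro_p p F TF X"
    and R: "R \<lhd> F" "closedin TF R"
    and \<pi>: "quotient_map TF T \<pi>" "\<pi> \<in> hom F G"
      "\<And>f g. \<lbrakk>f \<in> carrier F; g \<in> carrier F\<rbrakk> \<Longrightarrow> \<pi> f = \<pi> g \<longleftrightarrow> R #>\<^bsub>F\<^esub> f = R #>\<^bsub>F\<^esub> g"
begin

abbreviation "TK \<equiv> discrete_topology (carrier K)"

sublocale G: pro_p_group p G T
  by (rule G)

sublocale F: pro_p_group p F TF
  using free by (simp add: free_pro_p_def)

sublocale R: normal R F
  by (rule R(1))

text \<open>\<open>u\<close> exhibits the pullback to \<open>F\<close> of the normalized cocycle \<open>c\<close> as a coboundary.\<close>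

definition splits :: "('a \<Rightarrow> 'a \<Rightarrow> 'k) \<Rightarrow> ('f \<Rightarrow> 'k) \<Rightarrow> bool" where
  "splits c u \<longleftrightarrow> continuous_map TF TK u \<and> (\<forall>g\<in>carrier G. \<forall>h\<in>carrier G. c g h \<in> carrier K) \<and>
     (\<forall>g\<in>carrier G. c \<one>\<^bsub>G\<^esub> g = \<zero> \<and> c g \<one>\<^bsub>G\<^esub> = \<zero>) \<and>
     (\<forall>f\<in>carrier F. \<forall>g\<in>carrier F. u (f \<otimes>\<^bsub>F\<^esub> g) = u f \<oplus> u g \<oplus> c (\<pi> f) (\<pi> g))"

lemma continuous_map_TK:
  assumes "continuous_map Y TK f" "x \<in> topspace Y"
  shows "f x \<in> carrier K"
  using continuous_map_image_subset_topspace[OF assms(1)] assms(2) by auto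

lemma \<pi>_closed: "f \<in> carrier F \<Longrightarrow> \<pi> f \<in> carrier G"
  using \<pi>(2) by (auto simp: hom_def)

lemma \<pi>_mult: "\<lbrakk>f \<in> carrier F; g \<in> carrier F\<rbrakk> \<Longrightarrow> \<pi> (f \<otimes>\<^bsub>F\<^esub> g) = \<pi> f \<otimes>\<^bsub>G\<^esub> \<pi> g"
  using \<pi>(2) by (auto simp: hom_def)

lemma \<pi>_one: "\<pi> \<one>\<^bsub>F\<^esub> = \<one>\<^bsub>G\<^esub>"
  by (rule hom_one[OF \<pi>(2) F.group_axioms G.group_axioms])

lemma \<pi>_surj: "\<pi> ` carrier F = carrier G"
  using quotient_imp_surjective_map[OF \<pi>(1)] F.topspace_eq G.topspace_eq by simp

lemma \<pi>_relation: "r \<in> R \<Longrightarrow> \<pi> r = \<one>\<^bsub>G\<^esub>"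
  using \<pi>(3)[of r "\<one>\<^bsub>F\<^esub>"] \<pi>_one F.coset_join2[of r R] R.subgroup_axioms R.subset by auto

lemma splitsD:
  assumes "splits c u"
  shows "continuous_map TF TK u"
    and "\<lbrakk>g \<in> carrier G; h \<in> carrier G\<rbrakk> \<Longrightarrow> c g h \<in> carrier K"
    and "g \<in> carrier G \<Longrightarrow> c \<one>\<^bsub>G\<^esub> g = \<zero>" "g \<in> carrier G \<Longrightarrow> c g \<one>\<^bsub>G\<^esub> = \<zero>"
    and "\<lbrakk>f \<in> carrier F; f' \<in> carrier F\<rbrakk> \<Longrightarrow> u (f \<otimes>\<^bsub>F\<^esub> f') = u f \<oplus> u f' \<oplus> c (\<pi> f) (\<pi> f')"
    and "f \<in> carrier F \<Longrightarrow> u f \<in> carrier K"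
proof -
  show "continuous_map TF TK u"
    using assms by (simp add: splits_def)
  thus "f \<in> carrier F \<Longrightarrow> u f \<in> carrier K"
    using continuous_map_TK[of TF u f] F.topspace_eq by simp
qed (use assms in \<open>simp_all add: splits_def\<close>)

text \<open>As \<open>\<pi>\<close> is trivial on \<open>R\<close> and \<open>c\<close> is
  normalized, \<open>u\<close> is additive on \<open>R\<close>. Its zeros in \<open>R\<close> form a
  closed normal subgroup of \<open>F\<close>, which contains all of \<open>R\<close> once it
  contains normal generators.\<close>

lemma splits_relations:
  assumes c: "splits c u" and S: "S \<subseteq> R" "closed_normal_closure F TF S = R" "\<And>s. s \<in> S \<Longrightarrow> u s = \<zero>"
    and "r \<in> R"
  shows "u r = \<zero>"
proof -
  note [simp] = splitsD(2-6)[OF c] \<pi>_closed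
  have RF [simp]: "r \<in> carrier F" if "r \<in> R" for r
    using that R.subset by blast
  have one: "u \<one>\<^bsub>F\<^esub> = \<zero>"
    using splitsD(5)[OF c, of "\<one>\<^bsub>F\<^esub>" "\<one>\<^bsub>F\<^esub>"] by (simp add: \<pi>_one)
  have mult: "u (f \<otimes>\<^bsub>F\<^esub> r) = u f \<oplus> u r" if "f \<in> carrier F" "r \<in> R" for f r
    using that by (simp add: \<pi>_relation)
  let ?N = "{r \<in> R. u r = \<zero>}"
  have "subgroup ?N F"
  proof (rule F.subgroupI)
    fix a assume a: "a \<in> ?N"
    have "u (inv\<^bsub>F\<^esub> a) = u (inv\<^bsub>F\<^esub> a \<otimes>\<^bsub>F\<^esub> a)"
      using a mult[of "inv\<^bsub>F\<^esub> a" a] by simp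
    also have "\<dots> = \<zero>"
      using a one by simp
    finally show "inv\<^bsub>F\<^esub> a \<in> ?N"
      using a by simp
  next
    show "?N \<noteq> {}"
      using one R.one_closed by blast
  qed (use mult in auto)
  moreover have "f \<otimes>\<^bsub>F\<^esub> r \<otimes>\<^bsub>F\<^esub> inv\<^bsub>F\<^esub> f \<in> ?N" if f: "f \<in> carrier F" and r: "r \<in> ?N" for f r
  proof -
    \<comment> \<open>Right multiplication by \<open>r\<close> changes neither
      \<open>\<pi> f\<close> nor \<open>u f\<close>, so the conjugate has the same expansion as
      \<open>f\<close> times its inverse, that is, the value of \<open>u\<close> at 1.\<close>
    have "\<pi> (f \<otimes>\<^bsub>F\<^esub> r) = \<pi> f" "u (f \<otimes>\<^bsub>F\<^esub> r) = u f"
      using f r mult[of f r] \<pi>_mult[of f r] \<pi>_relation[of r] by simp_all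
    hence "u (f \<otimes>\<^bsub>F\<^esub> r \<otimes>\<^bsub>F\<^esub> inv\<^bsub>F\<^esub> f) = u f \<oplus> u (inv\<^bsub>F\<^esub> f) \<oplus> c (\<pi> f) (\<pi> (inv\<^bsub>F\<^esub> f))"
      using f r by simp
    also have "\<dots> = u (f \<otimes>\<^bsub>F\<^esub> inv\<^bsub>F\<^esub> f)"
      using f by (intro splitsD(5)[OF c, symmetric]) simp_all
    finally have "u (f \<otimes>\<^bsub>F\<^esub> r \<otimes>\<^bsub>F\<^esub> inv\<^bsub>F\<^esub> f) = \<zero>"
      using f one by simp
    thus ?thesis
      using f r one R.inv_op_closed2 by simp
  qed
  ultimately have "?N \<lhd> F"
    using F.normal_inv_iff by blast
  moreover have "closedin TF ?N"
  proof -
    have "closedin TF {x \<in> topspace TF. u x \<in> {\<zero>}}"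
      by (rule closedin_continuous_map_preimage[OF splitsD(1)[OF c]]) simp
    hence "closedin TF (R \<inter> {x \<in> topspace TF. u x \<in> {\<zero>}})"
      using R(2) by (rule closedin_Int[rotated])
    moreover have "R \<inter> {x \<in> topspace TF. u x \<in> {\<zero>}} = ?N"
      unfolding F.topspace_eq using R.subset by blast
    ultimately show ?thesis
      by simp
  qed
  moreover have "S \<subseteq> ?N"
    using S by auto
  ultimately have "closed_normal_closure F TF S \<subseteq> ?N"
    unfolding closed_normal_closure_def by blast
  thus ?thesis
    using S(2) assms(5) by blast
qed

text \<open>Points of one fibre differ by a left factor in \<open>R\<close>, where \<open>u\<close>
  vanishes and \<open>c\<close> contributes nothing. Continuity of \<open>v\<close> comes from the
  quotient map.\<close>

lemma splits_descends:
  assumes c: "splits c u" and "\<And>r. r \<in> R \<Longrightarrow> u r = \<zero>"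
  obtains v where "continuous_map T TK v"
    "\<forall>g\<in>carrier G. \<forall>h\<in>carrier G. v (g \<otimes>\<^bsub>G\<^esub> h) = v g \<oplus> v h \<oplus> c g h"
proof -
  have "u x = u y" if "x \<in> topspace TF" "y \<in> topspace TF" "\<pi> x = \<pi> y" for x y
  proof -
    have xy: "x \<in> carrier F" "y \<in> carrier F"
      using that F.topspace_eq by auto
    hence "x \<in> R #>\<^bsub>F\<^esub> y"
      using \<pi>(3) that(3) F.rcos_self R.subgroup_axioms by blast
    then obtain r where r: "r \<in> R" "x = r \<otimes>\<^bsub>F\<^esub> y"
      by (auto simp: r_coset_def)
    hence "u x = u r \<oplus> u y \<oplus> c (\<pi> r) (\<pi> y)"
      using xy R.subset splitsD(5)[OF c] by blast
    thus ?thesis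
      using assms(2)[OF r(1)] splitsD(3)[OF c \<pi>_closed] splitsD(6)[OF c] xy(2) r(1)
      by (simp add: \<pi>_relation)
  qed
  hence "\<exists>v. continuous_map T TK v \<and> (\<forall>x\<in>topspace TF. v (\<pi> x) = u x)"
  proof (rule quotient_map_lift_exists[OF \<pi>(1) splitsD(1)[OF c]])
    fix v assume "continuous_map T TK v" "\<And>x. x \<in> topspace TF \<Longrightarrow> v (\<pi> x) = u x"
    thus ?thesis
      by (intro exI[of _ v] conjI ballI)
  qed
  then obtain v where v: "continuous_map T TK v" "\<forall>x\<in>topspace TF. v (\<pi> x) = u x"
    by (elim exE conjE)
  show thesis
  proof (rule that[OF v(1)], intro ballI)
    fix g h assume "g \<in> carrier G" "h \<in> carrier G"
    then obtain f f' where "f \<in> carrier F" "f' \<in> carrier F" "g = \<pi> f" "h = \<pi> f'"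
      using \<pi>_surj by (metis imageE)
    thus "v (g \<otimes>\<^bsub>G\<^esub> h) = v g \<oplus> v h \<oplus> c g h"
      using v(2) splitsD(5)[OF c] F.topspace_eq by (simp add: \<pi>_mult[symmetric])
  qed
qed

text \<open>The product of discrete spaces is discrete, so every operation on
  \<open>carrier K\<close> is continuous.\<close>

lemma continuous_map_TK_binop:
  assumes "continuous_map Y TK f" "continuous_map Y TK g"
    and "\<And>a b. \<lbrakk>a \<in> carrier K; b \<in> carrier K\<rbrakk> \<Longrightarrow> h a b \<in> carrier K"
  shows "continuous_map Y TK (\<lambda>x. h (f x) (g x))"
proof -
  have "continuous_map (prod_topology TK TK) TK (\<lambda>(a, b). h a b)"
    using assms(3) by (auto simp: prod_topology_discrete_topology[symmetric])
  from continuous_map_compose[OF continuous_map_pairedI[OF assms(1,2)] this] show ?thesis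
    by (simp add: o_def)
qed

lemma continuous_map_TK_unop:
  assumes "continuous_map Y TK f" "\<And>a. a \<in> carrier K \<Longrightarrow> h a \<in> carrier K"
  shows "continuous_map Y TK (\<lambda>x. h (f x))"
  using continuous_map_TK_binop[OF assms(1,1), of "\<lambda>a _. h a"] assms(2) by simp

lemma splits_add:
  assumes c: "splits c u" and d: "splits d w"
  shows "splits (\<lambda>g h. c g h \<oplus> d g h) (\<lambda>f. u f \<oplus> w f)"
  unfolding splits_def
proof (intro conjI ballI)
  show "continuous_map TF TK (\<lambda>f. u f \<oplus> w f)"
    by (rule continuous_map_TK_binop[OF splitsD(1)[OF c] splitsD(1)[OF d]]) simp
  show "u (f \<otimes>\<^bsub>F\<^esub> g) \<oplus> w (f \<otimes>\<^bsub>F\<^esub> g) = u f \<oplus> w f \<oplus> (u g \<oplus> w g) \<oplus> (c (\<pi> f) (\<pi> g) \<oplus> d (\<pi> f) (\<pi> g))"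
    if "f \<in> carrier F" "g \<in> carrier F" for f g
    using that \<pi>_closed splitsD[OF c] splitsD[OF d] by (simp add: a_ac)
qed (use splitsD[OF c] splitsD[OF d] in simp_all)

lemma splits_smult:
  assumes c: "splits c u" and \<alpha>: "\<alpha> \<in> carrier K"
  shows "splits (\<lambda>g h. \<alpha> \<otimes> c g h) (\<lambda>f. \<alpha> \<otimes> u f)"
  unfolding splits_def
proof (intro conjI ballI)
  show "continuous_map TF TK (\<lambda>f. \<alpha> \<otimes> u f)"
    by (rule continuous_map_TK_unop[OF splitsD(1)[OF c]]) (use \<alpha> in simp)
  show "\<alpha> \<otimes> u (f \<otimes>\<^bsub>F\<^esub> g) = \<alpha> \<otimes> u f \<oplus> \<alpha> \<otimes> u g \<oplus> \<alpha> \<otimes> c (\<pi> f) (\<pi> g)"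
    if "f \<in> carrier F" "g \<in> carrier F" for f g
    using that \<alpha> \<pi>_closed splitsD[OF c] by (simp add: r_distr)
qed (use \<alpha> splitsD[OF c] in simp_all)

lemma splits_cup:
  assumes \<mu>: "continuous_map T TK \<mu>" "\<forall>g\<in>carrier G. \<forall>h\<in>carrier G. \<mu> (g \<otimes>\<^bsub>G\<^esub> h) = \<mu> g \<oplus> \<mu> h"
    and \<nu>: "continuous_map T TK \<nu>" "\<forall>g\<in>carrier G. \<forall>h\<in>carrier G. \<nu> (g \<otimes>\<^bsub>G\<^esub> h) = \<nu> g \<oplus> \<nu> h"
  obtains u where "splits (\<lambda>g h. \<mu> g \<otimes> \<nu> h) u"
proof -
  have car: "\<omega> g \<in> carrier K" if "continuous_map T TK \<omega>" "g \<in> carrier G" for \<omega> g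
    using continuous_map_TK[OF that(1)] that(2) G.topspace_eq by simp
  have one: "\<omega> \<one>\<^bsub>G\<^esub> = \<zero>" if "continuous_map T TK \<omega>"
    "\<forall>g\<in>carrier G. \<forall>h\<in>carrier G. \<omega> (g \<otimes>\<^bsub>G\<^esub> h) = \<omega> g \<oplus> \<omega> h" for \<omega>
    using that(2)[rule_format, of "\<one>\<^bsub>G\<^esub>" "\<one>\<^bsub>G\<^esub>"] car[OF that(1), of "\<one>\<^bsub>G\<^esub>"] by simp
  have comp: "continuous_map TF TK (\<lambda>f. \<omega> (\<pi> f))" if "continuous_map T TK \<omega>" for \<omega>
    using continuous_map_compose[OF quotient_imp_continuous_map[OF \<pi>(1)] that] by (simp add: o_def)
  obtain u where u: "continuous_map TF TK u"
      "\<forall>f\<in>carrier F. \<forall>g\<in>carrier F. u (f \<otimes>\<^bsub>F\<^esub> g) = u f \<oplus> u g \<oplus> \<mu> (\<pi> f) \<otimes> \<nu> (\<pi> g)"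
    using free_pro_p_cup_splits[OF prime card_K free comp[OF \<mu>(1)] comp[OF \<nu>(1)]]
      \<mu>(2)[rule_format, OF \<pi>_closed \<pi>_closed] \<nu>(2)[rule_format, OF \<pi>_closed \<pi>_closed] \<pi>_mult by auto
  have "splits (\<lambda>g h. \<mu> g \<otimes> \<nu> h) u"
    unfolding splits_def using u car[OF \<mu>(1)] car[OF \<nu>(1)] one[OF \<mu>] one[OF \<nu>] by auto
  thus thesis ..
qed

end

section \<open>Classes in low degrees\<close>

context presented_group
begin

abbreviation "C \<equiv> cochain_algebra K G T"
abbreviation "Z \<equiv> cocycle_algebra K G T"
abbreviation "B \<equiv> differential K G ` total_cochains K G T"
abbreviation "H \<equiv> cohomology_algebra K G T"

text \<open>All sequences of maps on tuples, continuous or not: an ambient additive group for the cochains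
  in which no continuity has to be checked.\<close>

definition all_cochains :: "(nat \<Rightarrow> ('a, 'k) cochain) set" where
  "all_cochains = {a. \<forall>n. a n \<in> tuples G n \<rightarrow>\<^sub>E carrier K}"

definition cochain_group :: "(nat \<Rightarrow> ('a, 'k) cochain) monoid" where
  "cochain_group = \<lparr>carrier = all_cochains, monoid.mult = add C, one = zero C\<rparr>"

text \<open>The cohomology class as a coset in the ambient group, meaningful before its argument is
  known to be a cocycle.\<close>

definition cl :: "(nat \<Rightarrow> ('a, 'k) cochain) \<Rightarrow> (nat \<Rightarrow> ('a, 'k) cochain) set" where
  "cl a = B #>\<^bsub>cochain_group\<^esub> a"

lemma all_cochains_eval:
  "a \<in> all_cochains \<Longrightarrow> t \<in> tuples G n \<Longrightarrow> a n t \<in> carrier K"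
  "a \<in> all_cochains \<Longrightarrow> t \<notin> tuples G n \<Longrightarrow> a n t = undefined"
  unfolding all_cochains_def by (blast intro: PiE_mem, blast intro: PiE_arb)

lemma all_cochainsI:
  assumes "\<And>n t. t \<in> tuples G n \<Longrightarrow> a n t \<in> carrier K" "\<And>n t. t \<notin> tuples G n \<Longrightarrow> a n t = undefined"
  shows "a \<in> all_cochains"
  unfolding all_cochains_def using assms by (blast intro: PiE_I)

lemma all_cochains_eqI:
  assumes "a \<in> all_cochains" "b \<in> all_cochains" "\<And>n t. t \<in> tuples G n \<Longrightarrow> a n t = b n t"
  shows "a = b"
proof (intro ext)
  fix n t
  show "a n t = b n t"
    using assms all_cochains_eval(2) by (cases "t \<in> tuples G n") metis+
qed

lemma cochain_simps:
  "(a \<oplus>\<^bsub>C\<^esub> b) n = (\<lambda>t\<in>tuples G n. a n t \<oplus> b n t)"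
  "\<zero>\<^bsub>C\<^esub> n = (\<lambda>t\<in>tuples G n. \<zero>)"
  "(c \<odot>\<^bsub>C\<^esub> a) n = (\<lambda>t\<in>tuples G n. c \<otimes> a n t)"
  by (simp_all add: cochain_algebra_def zero_cochain_def)

lemma cochain_add_closed: "\<lbrakk>a \<in> all_cochains; b \<in> all_cochains\<rbrakk> \<Longrightarrow> a \<oplus>\<^bsub>C\<^esub> b \<in> all_cochains"
  by (rule all_cochainsI) (simp_all add: cochain_simps all_cochains_eval)

lemma cochain_zero_closed: "\<zero>\<^bsub>C\<^esub> \<in> all_cochains"
  by (rule all_cochainsI) (simp_all add: cochain_simps)

lemma cochain_smult_closed: "\<lbrakk>c \<in> carrier K; a \<in> all_cochains\<rbrakk> \<Longrightarrow> c \<odot>\<^bsub>C\<^esub> a \<in> all_cochains"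
  by (rule all_cochainsI) (simp_all add: cochain_simps all_cochains_eval)

lemma cup_index:
  assumes "t \<in> tuples G n" "i \<le> n"
  shows "(\<lambda>j\<in>{..<i}. t j) \<in> tuples G i" "(\<lambda>j\<in>{..<n - i}. t (i + j)) \<in> tuples G (n - i)"
  using assms by (auto simp: PiE_iff)

lemma cochain_mult_eval:
  assumes "t \<in> tuples G n" "a \<in> all_cochains" "b \<in> all_cochains"
  shows "(a \<otimes>\<^bsub>C\<^esub> b) n t = (\<Oplus>i\<in>{..n}. a i (\<lambda>j\<in>{..<i}. t j) \<otimes> b (n - i) (\<lambda>j\<in>{..<n - i}. t (i + j)))"
proof -
  have "(a \<otimes>\<^bsub>C\<^esub> b) n t = (\<Oplus>i\<in>{..n}. cup K G i (n - i) (a i) (b (n - i)) t)"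
    using assms(1) by (simp add: cochain_algebra_def)
  also have "\<dots> = (\<Oplus>i\<in>{..n}. a i (\<lambda>j\<in>{..<i}. t j) \<otimes> b (n - i) (\<lambda>j\<in>{..<n - i}. t (i + j)))"
    using assms cup_index[OF assms(1)]
    by (intro finsum_cong') (auto simp: cup_def all_cochains_eval)
  finally show ?thesis .
qed

lemma cochain_mult_closed:
  assumes "a \<in> all_cochains" "b \<in> all_cochains"
  shows "a \<otimes>\<^bsub>C\<^esub> b \<in> all_cochains"
proof (rule all_cochainsI)
  fix n t
  show "(a \<otimes>\<^bsub>C\<^esub> b) n t \<in> carrier K" if t: "t \<in> tuples G n"
    unfolding cochain_mult_eval[OF that assms]
    using assms cup_index[OF t] by (intro finsum_closed Pi_I) (simp add: all_cochains_eval)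
  show "(a \<otimes>\<^bsub>C\<^esub> b) n t = undefined" if "t \<notin> tuples G n"
    using that by (simp add: cochain_algebra_def)
qed

lemma cochain_group_group: "group cochain_group"
proof (rule groupI)
  fix a assume a: "a \<in> carrier cochain_group"
  have "(\<lambda>n. \<lambda>t\<in>tuples G n. \<ominus> a n t) \<in> all_cochains"
    using a by (intro all_cochainsI) (simp_all add: cochain_group_def all_cochains_eval)
  moreover have "(\<lambda>n. \<lambda>t\<in>tuples G n. \<ominus> a n t) \<oplus>\<^bsub>C\<^esub> a = \<zero>\<^bsub>C\<^esub>"
    using a calculation by (intro all_cochains_eqI cochain_add_closed cochain_zero_closed)
      (simp_all add: cochain_group_def cochain_simps all_cochains_eval l_neg)
  ultimately show "\<exists>b\<in>carrier cochain_group. b \<otimes>\<^bsub>cochain_group\<^esub> a = \<one>\<^bsub>cochain_group\<^esub>"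
    by (auto simp: cochain_group_def)
next
  fix a b c assume "a \<in> carrier cochain_group" "b \<in> carrier cochain_group" "c \<in> carrier cochain_group"
  thus "a \<otimes>\<^bsub>cochain_group\<^esub> b \<otimes>\<^bsub>cochain_group\<^esub> c = a \<otimes>\<^bsub>cochain_group\<^esub> (b \<otimes>\<^bsub>cochain_group\<^esub> c)"
    unfolding cochain_group_def monoid.simps partial_object.simps
    by (intro all_cochains_eqI cochain_add_closed) (simp_all add: cochain_simps all_cochains_eval a_assoc)
next
  fix a assume "a \<in> carrier cochain_group"
  thus "\<one>\<^bsub>cochain_group\<^esub> \<otimes>\<^bsub>cochain_group\<^esub> a = a"
    unfolding cochain_group_def monoid.simps partial_object.simps
    by (intro all_cochains_eqI cochain_add_closed cochain_zero_closed)
      (simp_all add: cochain_simps all_cochains_eval)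
qed (simp_all add: cochain_group_def cochain_add_closed cochain_zero_closed)

sublocale CG: group cochain_group
  by (rule cochain_group_group)

lemma topspace_tuples: "topspace (product_topology (\<lambda>_. T) {..<n}) = tuples G n"
  by (simp add: G.topspace_eq)

lemma total_cochainsD:
  assumes "a \<in> total_cochains K G T"
  shows "a \<in> all_cochains" "continuous_map (product_topology (\<lambda>_. T) {..<n}) TK (a n)"
    "finite {n. a n \<noteq> zero_cochain K G n}"
proof -
  have *: "a n \<in> extensional (tuples G n)" "continuous_map (product_topology (\<lambda>_. T) {..<n}) TK (a n)" for n
    using assms unfolding total_cochains_def cochains_def by blast+
  show "continuous_map (product_topology (\<lambda>_. T) {..<n}) TK (a n)"
    by (rule *)
  show "finite {n. a n \<noteq> zero_cochain K G n}"
    using assms by (simp add: total_cochains_def)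
  show "a \<in> all_cochains"
  proof (rule all_cochainsI)
    show "a n t \<in> carrier K" if "t \<in> tuples G n" for n t
      using continuous_map_TK[OF *(2)] that topspace_tuples by metis
    show "a n t = undefined" if "t \<notin> tuples G n" for n t
      using *(1)[of n] that by (simp add: extensional_def)
  qed
qed

lemma total_cochainsI:
  assumes "\<And>n. continuous_map (product_topology (\<lambda>_. T) {..<n}) TK (f n)"
    and "finite S" "\<And>n t. \<lbrakk>n \<notin> S; t \<in> tuples G n\<rbrakk> \<Longrightarrow> f n t = \<zero>"
  shows "(\<lambda>n. \<lambda>t\<in>tuples G n. f n t) \<in> total_cochains K G T"
proof -
  have "continuous_map (product_topology (\<lambda>_. T) {..<n}) TK (\<lambda>t\<in>tuples G n. f n t)" for n
    by (rule continuous_map_eq[OF assms(1)]) (simp add: G.topspace_eq)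
  moreover have "(\<lambda>t\<in>tuples G n. f n t) = zero_cochain K G n" if "n \<notin> S" for n
    using assms(3)[OF that] by (auto simp: zero_cochain_def restrict_def)
  hence "{n. (\<lambda>t\<in>tuples G n. f n t) \<noteq> zero_cochain K G n} \<subseteq> S"
    by blast
  ultimately show ?thesis
    using finite_subset[OF _ assms(2)] by (simp add: total_cochains_def cochains_def)
qed

lemma face_tuples:
  assumes "t \<in> tuples G (Suc n)"
  shows "face G n j t \<in> tuples G n"
  using assms by (auto simp: face_def PiE_iff)

lemma differential_eval:
  assumes "t \<in> tuples G (Suc n)"
  shows "differential K G a (Suc n) t = (\<Oplus>j\<in>{..Suc n}. ((\<ominus> \<one>) [^] j) \<otimes> a n (face G n j t))"
  using assms by (simp add: differential_def coboundary_def)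

lemma differential_0: "differential K G a 0 = \<zero>\<^bsub>C\<^esub> 0"
  by (simp add: differential_def cochain_algebra_def)

lemma differential_closed:
  assumes "a \<in> all_cochains"
  shows "differential K G a \<in> all_cochains"
proof (rule all_cochainsI)
  fix n t
  show "differential K G a n t \<in> carrier K" if t: "t \<in> tuples G n"
  proof (cases n)
    case 0
    thus ?thesis
      using t by (simp add: differential_0 cochain_simps)
  next
    case (Suc m)
    hence t': "t \<in> tuples G (Suc m)"
      using t by simp
    show ?thesis
      unfolding Suc differential_eval[OF t'] using all_cochains_eval(1)[OF assms face_tuples[OF t']]
      by (intro finsum_closed Pi_I m_closed) simp_all
  qed
  show "differential K G a n t = undefined" if "t \<notin> tuples G n"
    using that by (cases n) (simp_all add: differential_def zero_cochain_def coboundary_def)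
qed

lemma differential_add:
  assumes "a \<in> all_cochains" "b \<in> all_cochains"
  shows "differential K G (a \<oplus>\<^bsub>C\<^esub> b) = differential K G a \<oplus>\<^bsub>C\<^esub> differential K G b"
proof (rule all_cochains_eqI)
  fix n t assume t: "t \<in> tuples G n"
  show "differential K G (a \<oplus>\<^bsub>C\<^esub> b) n t = (differential K G a \<oplus>\<^bsub>C\<^esub> differential K G b) n t"
  proof (cases n)
    case 0
    thus ?thesis
      using t by (simp add: differential_0 cochain_simps)
  next
    case (Suc m)
    have t': "t \<in> tuples G (Suc m)"
      using t Suc by simp
    note f = face_tuples[OF t']
    let ?s = "\<lambda>j::nat. (\<ominus> \<one>) [^] j"
    have "differential K G (a \<oplus>\<^bsub>C\<^esub> b) (Suc m) t =
        (\<Oplus>j\<in>{..Suc m}. ?s j \<otimes> a m (face G m j t) \<oplus> ?s j \<otimes> b m (face G m j t))"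
      unfolding differential_eval[OF t'] using f assms
      by (intro finsum_cong') (simp_all add: cochain_simps all_cochains_eval r_distr)
    also have "\<dots> = differential K G a (Suc m) t \<oplus> differential K G b (Suc m) t"
      unfolding differential_eval[OF t'] using f assms
      by (intro finsum_addf) (simp_all add: all_cochains_eval)
    finally show ?thesis
      using t' by (simp add: Suc cochain_simps)
  qed
qed (use assms in \<open>simp_all add: differential_closed cochain_add_closed\<close>)

lemma total_cochains_subgroup: "subgroup (total_cochains K G T) cochain_group"
proof (rule CG.subgroupI)
  show "total_cochains K G T \<subseteq> carrier cochain_group"
    using total_cochainsD(1) by (auto simp: cochain_group_def)
  have "(\<lambda>n. \<lambda>t\<in>tuples G n. \<zero>) \<in> total_cochains K G T"
    by (rule total_cochainsI[of _ "{}"]) simp_all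
  thus "total_cochains K G T \<noteq> {}"
    by blast
next
  fix a assume a: "a \<in> total_cochains K G T"
  let ?m = "\<lambda>n. \<lambda>t\<in>tuples G n. \<ominus> a n t"
  have m: "?m \<in> total_cochains K G T"
  proof (rule total_cochainsI[OF _ total_cochainsD(3)[OF a]])
    show "continuous_map (product_topology (\<lambda>_. T) {..<n}) TK (\<lambda>t. \<ominus> a n t)" for n
      by (rule continuous_map_TK_unop[OF total_cochainsD(2)[OF a]]) simp
  qed (simp add: zero_cochain_def)
  have "?m \<oplus>\<^bsub>C\<^esub> a = \<zero>\<^bsub>C\<^esub>"
    using total_cochainsD(1)[OF a] total_cochainsD(1)[OF m]
    by (intro all_cochains_eqI cochain_add_closed cochain_zero_closed)
      (simp_all add: cochain_simps all_cochains_eval l_neg)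
  hence "inv\<^bsub>cochain_group\<^esub> a = ?m"
    using total_cochainsD(1)[OF a] total_cochainsD(1)[OF m]
    by (intro CG.inv_equality) (simp_all add: cochain_group_def)
  thus "inv\<^bsub>cochain_group\<^esub> a \<in> total_cochains K G T"
    using m by simp
next
  fix a b assume a: "a \<in> total_cochains K G T" and b: "b \<in> total_cochains K G T"
  have "(\<lambda>n. \<lambda>t\<in>tuples G n. a n t \<oplus> b n t) \<in> total_cochains K G T"
  proof (rule total_cochainsI)
    show "finite ({n. a n \<noteq> zero_cochain K G n} \<union> {n. b n \<noteq> zero_cochain K G n})"
      using total_cochainsD(3)[OF a] total_cochainsD(3)[OF b] by simp
    show "continuous_map (product_topology (\<lambda>_. T) {..<n}) TK (\<lambda>t. a n t \<oplus> b n t)" for n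
      by (rule continuous_map_TK_binop[OF total_cochainsD(2)[OF a] total_cochainsD(2)[OF b]]) simp
  qed (simp add: zero_cochain_def)
  thus "a \<otimes>\<^bsub>cochain_group\<^esub> b \<in> total_cochains K G T"
    by (simp add: cochain_group_def cochain_algebra_def)
qed

section \<open>Cohomology classes as cosets of the coboundaries\<close>

lemma B_subgroup: "subgroup B cochain_group"
proof -
  have "differential K G \<in> hom cochain_group cochain_group"
    by (simp add: hom_def cochain_group_def differential_closed differential_add)
  hence "group_hom cochain_group cochain_group (differential K G)"
    by (simp add: group_hom_def group_hom_axioms_def CG.group_axioms)
  thus ?thesis
    using total_cochains_subgroup by (rule group_hom.subgroup_img_is_subgroup)
qed

lemma cl_self: "a \<in> all_cochains \<Longrightarrow> a \<in> cl a"
  unfolding cl_def using B_subgroup by (intro CG.rcos_self) (simp_all add: cochain_group_def)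

lemma cl_eq: "\<lbrakk>b \<in> cl a; a \<in> all_cochains\<rbrakk> \<Longrightarrow> cl b = cl a"
  unfolding cl_def using CG.repr_independence[OF _ _ B_subgroup, of b a] by (simp add: cochain_group_def)

lemma cl_boundary: "b \<in> B \<Longrightarrow> cl b = B"
  unfolding cl_def using B_subgroup subgroup.subset[OF B_subgroup] by (intro CG.coset_join2) auto

lemma Z_coset: "B +>\<^bsub>Z\<^esub> a = cl a"
  by (simp add: cl_def a_r_coset_def r_coset_def cocycle_algebra_def cochain_group_def)

text \<open>The operations of the quotient are defined on arbitrary sets, so they unfold to unions
  over representatives before anything is known about \<open>B\<close> as an ideal.\<close>

lemma H_simps:
  "carrier H = cl ` cocycles K G T" "\<zero>\<^bsub>H\<^esub> = B"
  "P \<otimes>\<^bsub>H\<^esub> Q = (\<Union>x\<in>P. \<Union>y\<in>Q. cl (x \<otimes>\<^bsub>C\<^esub> y))"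
  "P \<oplus>\<^bsub>H\<^esub> Q = (\<Union>x\<in>P. \<Union>y\<in>Q. {x \<oplus>\<^bsub>C\<^esub> y})"
  "c \<odot>\<^bsub>H\<^esub> P = (\<Union>x\<in>P. cl (c \<odot>\<^bsub>C\<^esub> x))"
  "component H n = cl ` (component C n \<inter> cocycles K G T)"
proof -
  have Z: "monoid.mult Z = monoid.mult C" "smult Z = smult C" "add Z = add C" "carrier Z = cocycles K G T"
    "component Z n = component C n \<inter> cocycles K G T" for n
    by (simp_all add: cocycle_algebra_def)
  show "carrier H = cl ` cocycles K G T" "\<zero>\<^bsub>H\<^esub> = B"
    by (auto simp: cohomology_algebra_def quotient_algebra_def FactRing_def A_RCOSETS_def' Z_coset Z)
  show "P \<otimes>\<^bsub>H\<^esub> Q = (\<Union>x\<in>P. \<Union>y\<in>Q. cl (x \<otimes>\<^bsub>C\<^esub> y))"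
    by (simp add: cohomology_algebra_def quotient_algebra_def FactRing_def rcoset_mult_def Z_coset Z)
  show "P \<oplus>\<^bsub>H\<^esub> Q = (\<Union>x\<in>P. \<Union>y\<in>Q. {x \<oplus>\<^bsub>C\<^esub> y})"
    by (simp add: cohomology_algebra_def quotient_algebra_def FactRing_def set_add_def' Z)
  show "c \<odot>\<^bsub>H\<^esub> P = (\<Union>x\<in>P. cl (c \<odot>\<^bsub>C\<^esub> x))"
    by (simp add: cohomology_algebra_def quotient_algebra_def Z_coset Z)
  show "component H n = cl ` (component C n \<inter> cocycles K G T)"
    by (simp add: cohomology_algebra_def quotient_algebra_def Z_coset[abs_def] Z)
qed

text \<open>That the product of two classes is the class of the product of representatives would follow
  from the Leibniz rule; but it is also forced by the product being a single coset.\<close>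

lemma cl_unique:
  assumes "P \<in> carrier H" "cl a \<subseteq> P" "a \<in> all_cochains"
  shows "P = cl a"
proof -
  obtain z where z: "z \<in> cocycles K G T" "P = cl z"
    using assms(1) by (auto simp: H_simps(1))
  hence "z \<in> all_cochains"
    using total_cochainsD(1) by (simp add: cocycles_def)
  thus ?thesis
    using cl_eq[of a z] cl_self[OF assms(3)] assms(2) z(2) by auto
qed

lemma cl_mult:
  assumes "cl a \<otimes>\<^bsub>H\<^esub> cl b \<in> carrier H" "a \<in> all_cochains" "b \<in> all_cochains"
  shows "cl a \<otimes>\<^bsub>H\<^esub> cl b = cl (a \<otimes>\<^bsub>C\<^esub> b)"
  using cl_self[OF assms(2)] cl_self[OF assms(3)] cochain_mult_closed[OF assms(2,3)]
  by (intro cl_unique[OF assms(1)]) (auto simp: H_simps(3))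

lemma cl_smult:
  assumes "c \<odot>\<^bsub>H\<^esub> cl a \<in> carrier H" "a \<in> all_cochains" "c \<in> carrier K"
  shows "c \<odot>\<^bsub>H\<^esub> cl a = cl (c \<odot>\<^bsub>C\<^esub> a)"
  using cl_self[OF assms(2)] cochain_smult_closed[OF assms(3,2)]
  by (intro cl_unique[OF assms(1)]) (auto simp: H_simps(5))

text \<open>A sum of classes is formed as a set of sums, not as a union of classes. It is therefore
  identified through a single element, which determines its coset.\<close>

lemma cl_add:
  assumes "cl a \<oplus>\<^bsub>H\<^esub> cl b \<in> carrier H" "a \<in> all_cochains" "b \<in> all_cochains"
  shows "cl a \<oplus>\<^bsub>H\<^esub> cl b = cl (a \<oplus>\<^bsub>C\<^esub> b)"
proof -
  obtain z where z: "z \<in> cocycles K G T" "cl a \<oplus>\<^bsub>H\<^esub> cl b = cl z"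
    using assms(1) by (auto simp: H_simps(1))
  hence "z \<in> all_cochains"
    using total_cochainsD(1) by (simp add: cocycles_def)
  moreover have "a \<oplus>\<^bsub>C\<^esub> b \<in> cl z"
    using cl_self[OF assms(2)] cl_self[OF assms(3)] z(2)[symmetric] by (auto simp: H_simps(4))
  ultimately show ?thesis
    using cl_eq z(2) by simp
qed

section \<open>Explicit cochains in degrees 1 and 2\<close>

definition cochain1 :: "('a \<Rightarrow> 'k) \<Rightarrow> nat \<Rightarrow> ('a, 'k) cochain" where
  "cochain1 v = (\<lambda>n. \<lambda>t\<in>tuples G n. if n = 1 then v (t 0) else \<zero>)"

definition cochain2 :: "('a \<Rightarrow> 'a \<Rightarrow> 'k) \<Rightarrow> nat \<Rightarrow> ('a, 'k) cochain" where
  "cochain2 c = (\<lambda>n. \<lambda>t\<in>tuples G n. if n = 2 then c (t 0) (t 1) else \<zero>)"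

lemma tuples_entry: "\<lbrakk>t \<in> tuples G n; i < n\<rbrakk> \<Longrightarrow> t i \<in> carrier G"
  by auto

lemma cochain1_closed:
  assumes "\<And>g. g \<in> carrier G \<Longrightarrow> v g \<in> carrier K"
  shows "cochain1 v \<in> all_cochains"
  by (rule all_cochainsI) (auto simp: cochain1_def assms tuples_entry)

lemma cochain2_closed:
  assumes "\<And>g h. \<lbrakk>g \<in> carrier G; h \<in> carrier G\<rbrakk> \<Longrightarrow> c g h \<in> carrier K"
  shows "cochain2 c \<in> all_cochains"
  by (rule all_cochainsI) (auto simp: cochain2_def assms tuples_entry)

lemma cochain1_total:
  assumes "continuous_map T TK v"
  shows "cochain1 v \<in> total_cochains K G T"
  unfolding cochain1_def
proof (rule total_cochainsI[where S = "{1}"])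
  fix n :: nat
  show "continuous_map (product_topology (\<lambda>_. T) {..<n}) TK (\<lambda>t. if n = 1 then v (t 0) else \<zero>)"
  proof (cases "n = 1")
    case True
    have "continuous_map (product_topology (\<lambda>_. T) {..<n}) T (\<lambda>t. t 0)"
      by (rule continuous_map_product_projection) (simp add: True)
    from continuous_map_compose[OF this assms] show ?thesis
      using True by (simp add: o_def)
  qed simp
qed simp_all

lemma differential_cochain1:
  assumes v: "\<And>g. g \<in> carrier G \<Longrightarrow> v g \<in> carrier K"
  shows "differential K G (cochain1 v) = cochain2 (\<lambda>g h. v h \<ominus> v (g \<otimes>\<^bsub>G\<^esub> h) \<oplus> v g)"
proof (rule all_cochains_eqI)
  show "differential K G (cochain1 v) \<in> all_cochains"
    using v by (intro differential_closed cochain1_closed)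
  show "cochain2 (\<lambda>g h. v h \<ominus> v (g \<otimes>\<^bsub>G\<^esub> h) \<oplus> v g) \<in> all_cochains"
    using v by (intro cochain2_closed) simp
  fix n t assume t: "t \<in> tuples G n"
  show "differential K G (cochain1 v) n t = cochain2 (\<lambda>g h. v h \<ominus> v (g \<otimes>\<^bsub>G\<^esub> h) \<oplus> v g) n t"
  proof (cases n)
    case 0
    thus ?thesis
      using t by (simp add: differential_0 cochain_simps cochain2_def)
  next
    case (Suc m)
    have t': "t \<in> tuples G (Suc m)"
      using t Suc by simp
    note f = face_tuples[OF t']
    show ?thesis
    proof (cases "m = 1")
      case True
      have t2: "t \<in> tuples G 2" "t \<in> tuples G (Suc 1)"
        using t Suc True by (simp_all add: numeral_2_eq_2)
      have entries: "t 0 \<in> carrier G" "t 1 \<in> carrier G"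
        using t2(1) by (auto intro: tuples_entry)
      have e: "cochain1 v 1 (face G 1 j t) = v (face G 1 j t 0)" for j
        using f[of j] True by (simp add: cochain1_def)
      \<comment> \<open>The faces appear in the order 2, 1, 0 because \<open>finsum_Suc\<close>
        splits off the last index.\<close>
      have "differential K G (cochain1 v) (Suc 1) t =
          (\<ominus> \<one>) [^] (2::nat) \<otimes> v (t 0) \<oplus> ((\<ominus> \<one>) [^] (1::nat) \<otimes> v (t 0 \<otimes>\<^bsub>G\<^esub> t 1) \<oplus> (\<ominus> \<one>) [^] (0::nat) \<otimes> v (t 1))"
      proof -
        have face: "face G 1 0 t 0 = t 1" "face G 1 1 t 0 = t 0 \<otimes>\<^bsub>G\<^esub> t 1" "face G 1 2 t 0 = t 0"
          by (simp_all add: face_def)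
        have "v (face G 1 j t 0) \<in> carrier K" for j
          using v f[of j] True by (auto intro: tuples_entry)
        hence "(\<lambda>j. (\<ominus> \<one>) [^] j \<otimes> v (face G 1 j t 0)) \<in> A \<rightarrow> carrier K" for A :: "nat set"
          by simp
        thus ?thesis
          unfolding differential_eval[OF t2(2)] e unfolding One_nat_def
          by (simp only: finsum_Suc finsum_0 face[unfolded One_nat_def numeral_2_eq_2] numeral_2_eq_2)
      qed
      also have "\<dots> = v (t 1) \<ominus> v (t 0 \<otimes>\<^bsub>G\<^esub> t 1) \<oplus> v (t 0)"
        using v entries by (simp add: numeral_2_eq_2 l_minus r_minus a_minus_def a_ac)
      finally show ?thesis
        using t2(1) by (simp add: Suc True cochain2_def numeral_2_eq_2)
    next
      case False
      hence "cochain1 v m (face G m j t) = \<zero>" for j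
        using f[of j] by (simp add: cochain1_def)
      thus ?thesis
        using t False by (simp add: Suc differential_eval cochain2_def del: finsum_Suc)
    qed
  qed
qed

lemma cochain1_mult:
  assumes v: "\<And>g. g \<in> carrier G \<Longrightarrow> v g \<in> carrier K" and w: "\<And>g. g \<in> carrier G \<Longrightarrow> w g \<in> carrier K"
  shows "cochain1 v \<otimes>\<^bsub>C\<^esub> cochain1 w = cochain2 (\<lambda>g h. v g \<otimes> w h)"
proof (rule all_cochains_eqI)
  have V: "cochain1 v \<in> all_cochains"
    using v by (rule cochain1_closed)
  have W: "cochain1 w \<in> all_cochains"
    using w by (rule cochain1_closed)
  show "cochain1 v \<otimes>\<^bsub>C\<^esub> cochain1 w \<in> all_cochains"
    by (rule cochain_mult_closed[OF V W])
  show "cochain2 (\<lambda>g h. v g \<otimes> w h) \<in> all_cochains"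
    using v w by (intro cochain2_closed) simp
  fix n t assume t: "t \<in> tuples G n"
  let ?f = "\<lambda>i. cochain1 v i (\<lambda>j\<in>{..<i}. t j) \<otimes> cochain1 w (n - i) (\<lambda>j\<in>{..<n - i}. t (i + j))"
  define x where "x = (if n = 2 then v (t 0) \<otimes> w (t 1) else \<zero>)"
  have x: "x \<in> carrier K"
    unfolding x_def using t v w by (simp add: tuples_entry)
  \<comment> \<open>Only the splitting of degree 2 as 1 + 1 contributes; \<open>x\<close> is already
    zero when \<open>n\<close> is not 2.\<close>
  have f: "?f i = (if 1 = i then x else \<zero>)" if "i \<le> n" for i
  proof -
    note tup = cup_index[OF t that]
    have K: "cochain1 v i (\<lambda>j\<in>{..<i}. t j) \<in> carrier K"
      "cochain1 w (n - i) (\<lambda>j\<in>{..<n - i}. t (i + j)) \<in> carrier K"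
      using all_cochains_eval(1)[OF V tup(1)] all_cochains_eval(1)[OF W tup(2)] .
    consider "i \<noteq> 1" | "i = 1" "n \<noteq> 2" | "i = 1" "n = 2"
      by blast
    thus ?thesis
    proof cases
      case 1
      hence "cochain1 v i (\<lambda>j\<in>{..<i}. t j) = \<zero>"
        using tup(1) by (simp only: cochain1_def restrict_apply if_True if_False)
      thus ?thesis
        using 1 K(2) by simp
    next
      case 2
      hence "n - i \<noteq> 1"
        using that by simp
      hence "cochain1 w (n - i) (\<lambda>j\<in>{..<n - i}. t (i + j)) = \<zero>"
        using tup(2) by (simp only: cochain1_def restrict_apply if_True if_False)
      thus ?thesis
        using 2 K(1) by (simp add: x_def)
    next
      case 3
      hence "n - i = 1"
        by simp
      hence "cochain1 v i (\<lambda>j\<in>{..<i}. t j) = v (t 0)"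
        "cochain1 w (n - i) (\<lambda>j\<in>{..<n - i}. t (i + j)) = w (t 1)"
        using tup 3 by (simp_all add: cochain1_def)
      thus ?thesis
        using 3 by (simp add: x_def)
    qed
  qed
  have "(cochain1 v \<otimes>\<^bsub>C\<^esub> cochain1 w) n t = (\<Oplus>i\<in>{..n}. ?f i)"
    by (rule cochain_mult_eval[OF t V W])
  also have "\<dots> = (\<Oplus>i\<in>{..n}. if 1 = i then x else \<zero>)"
    using f x by (intro finsum_cong') simp_all
  also have "\<dots> = x"
  \<comment> \<open>For \<open>n = 0\<close> the index 1 is out of range, and \<open>x\<close> is
    zero.\<close>
  proof (cases "n = 0")
    case True
    thus ?thesis
      by (simp add: x_def)
  next
    case False
    thus ?thesis
      using x by (intro finsum_singleton[where f = "\<lambda>_. x"]) simp_all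
  qed
  finally show "(cochain1 v \<otimes>\<^bsub>C\<^esub> cochain1 w) n t = cochain2 (\<lambda>g h. v g \<otimes> w h) n t"
    using t by (simp add: cochain2_def x_def)
qed

text \<open>For trivial coefficients a 1-cocycle is a homomorphism: the cocycle condition at the
  pair \<open>g\<close>, \<open>h\<close> is additivity.\<close>

lemma component_1E:
  assumes "P \<in> component H 1"
  obtains v where "P = cl (cochain1 v)" "continuous_map T TK v"
    "\<forall>g\<in>carrier G. \<forall>h\<in>carrier G. v (g \<otimes>\<^bsub>G\<^esub> h) = v g \<oplus> v h"
proof -
  obtain a where a: "a \<in> component C 1" "a \<in> cocycles K G T" "P = cl a"
    using assms by (auto simp: H_simps(6))
  have tot: "a \<in> total_cochains K G T" and d: "differential K G a = zero_cochain K G"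
    using a(2) by (auto simp: cocycles_def)
  define v where "v g = a 1 (\<lambda>i\<in>{..<1}. g)" for g
  \<comment> \<open>Tuples are undefined outside their index set, so a 1-tuple is recovered from its
    only entry.\<close>
  have t1: "(\<lambda>i\<in>{..<1}. t 0) = t" if "t \<in> tuples G 1" for t
    using that by (intro ext) (auto simp: PiE_iff extensional_def)
  have "continuous_map T (product_topology (\<lambda>_. T) {..<1}) (\<lambda>g. \<lambda>i\<in>{..<1::nat}. g)"
    unfolding continuous_map_componentwise by (auto intro: continuous_map_eq[OF continuous_map_id])
  from continuous_map_compose[OF this total_cochainsD(2)[OF tot]]
  have v: "continuous_map T TK v"
    by (simp add: o_def v_def[abs_def])
  hence vK: "v g \<in> carrier K" if "g \<in> carrier G" for g
    using continuous_map_TK that G.topspace_eq by metis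
  have "cochain1 v \<in> all_cochains"
    using vK by (rule cochain1_closed)
  with total_cochainsD(1)[OF tot] have av: "a = cochain1 v"
  proof (rule all_cochains_eqI)
    fix n t assume t: "t \<in> tuples G n"
    show "a n t = cochain1 v n t"
    proof (cases "n = 1")
      case True
      thus ?thesis
        using t t1[of t] by (simp add: cochain1_def v_def)
    next
      case False
      hence "a n = zero_cochain K G n"
        using a(1) by (simp add: cochain_algebra_def)
      thus ?thesis
        using t False by (simp add: cochain1_def zero_cochain_def)
    qed
  qed
  have "v (g \<otimes>\<^bsub>G\<^esub> h) = v g \<oplus> v h" if g: "g \<in> carrier G" and h: "h \<in> carrier G" for g h
  proof -
    define t where "t = (\<lambda>i\<in>{..<2::nat}. if i = 0 then g else h)"
    have t: "t \<in> tuples G 2"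
      using g h by (auto simp: t_def)
    have "cochain2 (\<lambda>g h. v h \<ominus> v (g \<otimes>\<^bsub>G\<^esub> h) \<oplus> v g) 2 t = \<zero>"
      using d t differential_cochain1[of v] vK by (simp add: av zero_cochain_def)
    hence "v h \<ominus> v (g \<otimes>\<^bsub>G\<^esub> h) \<oplus> v g = \<zero>"
      using t by (simp add: cochain2_def) (simp add: t_def)
    moreover have "v g \<in> carrier K" "v h \<in> carrier K" "v (g \<otimes>\<^bsub>G\<^esub> h) \<in> carrier K"
      using vK g h by auto
    moreover have "v g \<oplus> v h = (v h \<ominus> v (g \<otimes>\<^bsub>G\<^esub> h) \<oplus> v g) \<oplus> v (g \<otimes>\<^bsub>G\<^esub> h)"
      using calculation(2-) by algebra
    ultimately show ?thesis
      by simp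
  qed
  thus thesis
    using that v a(3) av by blast
qed


section \<open>Classes that become trivial on the free group\<close>

text \<open>A relation and not a function of \<open>P\<close>: any choice of \<open>u\<close> will
  do, provided that choices can be added and scaled along with the classes.\<close>

definition split_class :: "(nat \<Rightarrow> ('a, 'k) cochain) set \<Rightarrow> ('f \<Rightarrow> 'k) \<Rightarrow> bool" where
  "split_class P u \<longleftrightarrow> (\<exists>c. P = cl (cochain2 c) \<and> splits c u)"

lemma component_H_carrier: "P \<in> component H n \<Longrightarrow> P \<in> carrier H"
  by (auto simp: H_simps(1,6))

lemma splits_cochain2: "splits c u \<Longrightarrow> cochain2 c \<in> all_cochains"
  by (rule cochain2_closed) (rule splitsD(2))

text \<open>Both factors are classes of continuous homomorphisms, to which \<open>splits_cup\<close>
  applies; \<open>ring H\<close> guarantees that the product is a class, as \<open>cl_mult\<close>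
  requires.\<close>

lemma split_class_mult:
  assumes "ring H" "P \<in> component H 1" "Q \<in> component H 1"
  obtains u where "split_class (P \<otimes>\<^bsub>H\<^esub> Q) u"
proof -
  interpret H: ring H by fact
  obtain v where v: "P = cl (cochain1 v)" "continuous_map T TK v"
      "\<forall>g\<in>carrier G. \<forall>h\<in>carrier G. v (g \<otimes>\<^bsub>G\<^esub> h) = v g \<oplus> v h"
    using assms(2) by (rule component_1E)
  obtain w where w: "Q = cl (cochain1 w)" "continuous_map T TK w"
      "\<forall>g\<in>carrier G. \<forall>h\<in>carrier G. w (g \<otimes>\<^bsub>G\<^esub> h) = w g \<oplus> w h"
    using assms(3) by (rule component_1E)
  obtain u where u: "splits (\<lambda>g h. v g \<otimes> w h) u"
    by (rule splits_cup[OF v(2,3) w(2,3)])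
  have vw: "v g \<in> carrier K" "w g \<in> carrier K" if "g \<in> carrier G" for g
    using that continuous_map_TK[OF v(2)] continuous_map_TK[OF w(2)] G.topspace_eq by simp_all
  have "P \<otimes>\<^bsub>H\<^esub> Q \<in> carrier H"
    using assms(2,3) component_H_carrier by simp
  hence "P \<otimes>\<^bsub>H\<^esub> Q = cl (cochain1 v \<otimes>\<^bsub>C\<^esub> cochain1 w)"
    unfolding v(1) w(1) by (rule cl_mult) (rule cochain1_closed, rule vw, assumption)+
  also have "cochain1 v \<otimes>\<^bsub>C\<^esub> cochain1 w = cochain2 (\<lambda>g h. v g \<otimes> w h)"
    by (rule cochain1_mult) (rule vw, assumption)+
  finally show thesis
    using that u unfolding split_class_def by blast
qed

lemma split_class_add:
  assumes "ring H" "P \<in> carrier H" "Q \<in> carrier H" "split_class P u" "split_class Q w"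
  shows "split_class (P \<oplus>\<^bsub>H\<^esub> Q) (\<lambda>f. u f \<oplus> w f)"
proof -
  interpret H: ring H by fact
  obtain c where c: "P = cl (cochain2 c)" "splits c u"
    using assms(4) by (auto simp: split_class_def)
  obtain d where d: "Q = cl (cochain2 d)" "splits d w"
    using assms(5) by (auto simp: split_class_def)
  have "P \<oplus>\<^bsub>H\<^esub> Q \<in> carrier H"
    using assms(2,3) by simp
  hence "P \<oplus>\<^bsub>H\<^esub> Q = cl (cochain2 c \<oplus>\<^bsub>C\<^esub> cochain2 d)"
    unfolding c(1) d(1) by (rule cl_add) (rule splits_cochain2[OF c(2)], rule splits_cochain2[OF d(2)])
  also have "cochain2 c \<oplus>\<^bsub>C\<^esub> cochain2 d = cochain2 (\<lambda>g h. c g h \<oplus> d g h)"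
    by (intro ext) (simp add: cochain_simps cochain2_def)
  finally show ?thesis
    using splits_add[OF c(2) d(2)] by (auto simp: split_class_def)
qed

lemma split_class_smult:
  assumes "Module.module K H" "P \<in> carrier H" "split_class P u" and \<alpha>: "\<alpha> \<in> carrier K"
  shows "split_class (\<alpha> \<odot>\<^bsub>H\<^esub> P) (\<lambda>f. \<alpha> \<otimes> u f)"
proof -
  obtain c where c: "P = cl (cochain2 c)" "splits c u"
    using assms(3) by (auto simp: split_class_def)
  have "\<alpha> \<odot>\<^bsub>H\<^esub> P \<in> carrier H"
    by (rule module.smult_closed[OF assms(1) \<alpha> assms(2)])
  hence "\<alpha> \<odot>\<^bsub>H\<^esub> P = cl (\<alpha> \<odot>\<^bsub>C\<^esub> cochain2 c)"
    unfolding c(1) by (rule cl_smult) (rule splits_cochain2[OF c(2)], rule \<alpha>)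
  also have "\<alpha> \<odot>\<^bsub>C\<^esub> cochain2 c = cochain2 (\<lambda>g h. \<alpha> \<otimes> c g h)"
    using \<alpha> by (intro ext) (simp add: cochain_simps cochain2_def)
  finally show ?thesis
    using splits_smult[OF c(2) \<alpha>] by (auto simp: split_class_def)
qed

lemma cochain2_boundary:
  assumes "continuous_map T TK v"
  shows "cl (cochain2 (\<lambda>g h. v h \<ominus> v (g \<otimes>\<^bsub>G\<^esub> h) \<oplus> v g)) = \<zero>\<^bsub>H\<^esub>"
proof -
  have "v g \<in> carrier K" if "g \<in> carrier G" for g
    using that continuous_map_TK[OF assms] G.topspace_eq by simp
  hence "differential K G (cochain1 v) = cochain2 (\<lambda>g h. v h \<ominus> v (g \<otimes>\<^bsub>G\<^esub> h) \<oplus> v g)"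
    by (rule differential_cochain1)
  thus ?thesis
    unfolding H_simps(2) using cochain1_total[OF assms] by (intro cl_boundary) (metis image_eqI)
qed

lemma cochain2_cong:
  assumes "\<And>g h. \<lbrakk>g \<in> carrier G; h \<in> carrier G\<rbrakk> \<Longrightarrow> c g h = d g h"
  shows "cochain2 c = cochain2 d"
proof (intro ext)
  fix n t
  show "cochain2 c n t = cochain2 d n t"
    using assms[of "t 0" "t 1"] tuples_entry[of t 2 0] tuples_entry[of t 2 1]
    by (simp add: cochain2_def)
qed

lemma split_class_zero:
  assumes "split_class P u" "S \<subseteq> R" "closed_normal_closure F TF S = R" "\<And>s. s \<in> S \<Longrightarrow> u s = \<zero>"
  shows "P = \<zero>\<^bsub>H\<^esub>"
proof -
  obtain c where c: "P = cl (cochain2 c)" "splits c u"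
    using assms(1) by (auto simp: split_class_def)
  have "u r = \<zero>" if "r \<in> R" for r
    using c(2) assms(2-4) that by (rule splits_relations)
  with c(2) obtain v where v: "continuous_map T TK v"
    "\<forall>g\<in>carrier G. \<forall>h\<in>carrier G. v (g \<otimes>\<^bsub>G\<^esub> h) = v g \<oplus> v h \<oplus> c g h"
    by (rule splits_descends)
  have vK: "v g \<in> carrier K" if "g \<in> carrier G" for g
    using that continuous_map_TK[OF v(1)] G.topspace_eq by simp
  \<comment> \<open>In the convention of \<open>splits\<close> the function \<open>c\<close> is
    minus the coboundary of \<open>v\<close>, hence the sign.\<close>
  have "cochain2 c = cochain2 (\<lambda>g h. \<ominus> v h \<ominus> (\<ominus> v (g \<otimes>\<^bsub>G\<^esub> h)) \<oplus> \<ominus> v g)"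
  proof (rule cochain2_cong)
    fix g h assume gh: "g \<in> carrier G" "h \<in> carrier G"
    note K = vK[OF gh(1)] vK[OF gh(2)] splitsD(2)[OF c(2) gh]
    show "c g h = \<ominus> v h \<ominus> (\<ominus> v (g \<otimes>\<^bsub>G\<^esub> h)) \<oplus> \<ominus> v g"
      unfolding v(2)[rule_format, OF gh] using K by algebra
  qed
  moreover have "continuous_map T TK (\<lambda>g. \<ominus> v g)"
    by (rule continuous_map_TK_unop[OF v(1)]) simp
  ultimately show ?thesis
    using cochain2_boundary c(1) by simp
qed

text \<open>\<open>v\<^sup>2\<close> is minus the coboundary of \<open>v\<^sup>2/2\<close>, the latter square being pointwise.\<close>

lemma class_square_zero:
  assumes "ring H" "P \<in> component H 1" "\<one> \<oplus> \<one> \<noteq> \<zero>"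
  shows "P \<otimes>\<^bsub>H\<^esub> P = \<zero>\<^bsub>H\<^esub>"
proof -
  interpret H: ring H by fact
  obtain v where v: "P = cl (cochain1 v)" "continuous_map T TK v"
      "\<forall>g\<in>carrier G. \<forall>h\<in>carrier G. v (g \<otimes>\<^bsub>G\<^esub> h) = v g \<oplus> v h"
    using assms(2) by (rule component_1E)
  have vK: "v g \<in> carrier K" if "g \<in> carrier G" for g
    using that continuous_map_TK[OF v(2)] G.topspace_eq by simp
  have "P \<otimes>\<^bsub>H\<^esub> P \<in> carrier H"
    using assms(2) component_H_carrier by simp
  hence "P \<otimes>\<^bsub>H\<^esub> P = cl (cochain1 v \<otimes>\<^bsub>C\<^esub> cochain1 v)"
    unfolding v(1) by (rule cl_mult) (rule cochain1_closed, rule vK, assumption)+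
  also have "cochain1 v \<otimes>\<^bsub>C\<^esub> cochain1 v = cochain2 (\<lambda>g h. v g \<otimes> v h)"
    by (rule cochain1_mult) (rule vK, assumption)+
  finally have P: "P \<otimes>\<^bsub>H\<^esub> P = cl (cochain2 (\<lambda>g h. v g \<otimes> v h))" .
  define \<eta> where "\<eta> = inv (\<one> \<oplus> \<one>)"
  have \<eta>: "\<eta> \<in> carrier K" "\<eta> \<otimes> (\<one> \<oplus> \<one>) = \<one>"
    using assms(3) field_Units by (auto simp: \<eta>_def intro: Units_l_inv)
  let ?w = "\<lambda>g. \<ominus> (\<eta> \<otimes> (v g \<otimes> v g))"
  have "cochain2 (\<lambda>g h. v g \<otimes> v h) = cochain2 (\<lambda>g h. ?w h \<ominus> ?w (g \<otimes>\<^bsub>G\<^esub> h) \<oplus> ?w g)"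
  proof (rule cochain2_cong)
    fix g h assume gh: "g \<in> carrier G" "h \<in> carrier G"
    note K = vK[OF gh(1)] vK[OF gh(2)] \<eta>(1)
    have "?w h \<ominus> ?w (g \<otimes>\<^bsub>G\<^esub> h) \<oplus> ?w g = \<eta> \<otimes> (\<one> \<oplus> \<one>) \<otimes> (v g \<otimes> v h)"
      unfolding v(3)[rule_format, OF gh] using K by algebra
    thus "v g \<otimes> v h = ?w h \<ominus> ?w (g \<otimes>\<^bsub>G\<^esub> h) \<oplus> ?w g"
      using K \<eta>(2) by simp
  qed
  moreover have "continuous_map T TK ?w"
    by (rule continuous_map_TK_unop[OF v(2)]) (simp add: \<eta>(1))
  ultimately show ?thesis
    using cochain2_boundary P by simp
qed

text \<open>Each class yields the vector of values of its \<open>u\<close> at \<open>r1\<close> and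
  \<open>r2\<close>. A relation between three such vectors makes the combined function vanish on
  \<open>S\<close>, and then the combined class is zero.\<close>

lemma degree_2_dependent:
  assumes "ring H" "Module.module K H" "component H 2 \<subseteq> component H 1 \<cdot>\<^bsub>H\<^esub> component H 1"
    and S: "S \<subseteq> R" "closed_normal_closure F TF S = R" "S \<subseteq> {r1, r2}" "r1 \<in> R" "r2 \<in> R"
    and P: "P1 \<in> component H 2" "P2 \<in> component H 2" "P3 \<in> component H 2"
  shows "\<exists>\<alpha>\<in>carrier K. \<exists>\<beta>\<in>carrier K. \<exists>\<gamma>\<in>carrier K. (\<alpha> \<noteq> \<zero> \<or> \<beta> \<noteq> \<zero> \<or> \<gamma> \<noteq> \<zero>) \<and>
    \<alpha> \<odot>\<^bsub>H\<^esub> P1 \<oplus>\<^bsub>H\<^esub> \<beta> \<odot>\<^bsub>H\<^esub> P2 \<oplus>\<^bsub>H\<^esub> \<gamma> \<odot>\<^bsub>H\<^esub> P3 = \<zero>\<^bsub>H\<^esub>"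
proof -
  interpret H: ring H by fact
  interpret HM: module K H by fact
  have split: "P \<in> carrier H \<and> (\<exists>u. split_class P u)" if "P \<in> component H 2" for P
  proof -
    have "P \<in> component H 1 \<cdot>\<^bsub>H\<^esub> component H 1"
      using that assms(3) by blast
    thus ?thesis
    proof induction
      case (prod i j)
      obtain u where "split_class (i \<otimes>\<^bsub>H\<^esub> j) u"
        using assms(1) prod by (rule split_class_mult)
      thus ?case
        using prod component_H_carrier by blast
    next
      case (sum s1 s2)
      then obtain u w where "s1 \<in> carrier H" "s2 \<in> carrier H" "split_class s1 u" "split_class s2 w"
        by blast
      thus ?case
        using split_class_add[OF assms(1), of s1 s2 u w] by (intro conjI exI) simp_all
    qed
  qed
  obtain u1 where 1: "P1 \<in> carrier H" "split_class P1 u1"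
    using split[OF P(1)] by blast
  obtain u2 where 2: "P2 \<in> carrier H" "split_class P2 u2"
    using split[OF P(2)] by blast
  obtain u3 where 3: "P3 \<in> carrier H" "split_class P3 u3"
    using split[OF P(3)] by blast
  have K: "u r \<in> carrier K" if "split_class P u" "r \<in> R" for P u r
    using that splitsD(6) R.subset unfolding split_class_def by blast
  obtain \<alpha> \<beta> \<gamma> where abc: "\<alpha> \<in> carrier K" "\<beta> \<in> carrier K" "\<gamma> \<in> carrier K"
    and nz: "\<alpha> \<noteq> \<zero> \<or> \<beta> \<noteq> \<zero> \<or> \<gamma> \<noteq> \<zero>"
    and r: "\<alpha> \<otimes> u1 r1 \<oplus> \<beta> \<otimes> u2 r1 \<oplus> \<gamma> \<otimes> u3 r1 = \<zero>" "\<alpha> \<otimes> u1 r2 \<oplus> \<beta> \<otimes> u2 r2 \<oplus> \<gamma> \<otimes> u3 r2 = \<zero>"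
    by (rule exists_orthogonal[of "u1 r1" "u2 r1" "u3 r1" "u1 r2" "u2 r2" "u3 r2"])
      (use K[OF 1(2)] K[OF 2(2)] K[OF 3(2)] S(4,5) in auto)
  have "split_class (\<alpha> \<odot>\<^bsub>H\<^esub> P1 \<oplus>\<^bsub>H\<^esub> \<beta> \<odot>\<^bsub>H\<^esub> P2 \<oplus>\<^bsub>H\<^esub> \<gamma> \<odot>\<^bsub>H\<^esub> P3)
      (\<lambda>f. \<alpha> \<otimes> u1 f \<oplus> \<beta> \<otimes> u2 f \<oplus> \<gamma> \<otimes> u3 f)"
    using 1 2 3 abc
    by (intro split_class_add[OF assms(1)] split_class_smult[OF assms(2)] HM.smult_closed H.a_closed)
  hence "\<alpha> \<odot>\<^bsub>H\<^esub> P1 \<oplus>\<^bsub>H\<^esub> \<beta> \<odot>\<^bsub>H\<^esub> P2 \<oplus>\<^bsub>H\<^esub> \<gamma> \<odot>\<^bsub>H\<^esub> P3 = \<zero>\<^bsub>H\<^esub>"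
    by (rule split_class_zero[OF _ S(1,2)]) (use S(3) r in auto)
  thus ?thesis
    using abc nz by blast
qed

end

text \<open>Pads the relations to two elements, possibly equal, so that one argument covers zero,
  one and two relations.\<close>

lemma subset_pair:
  assumes "finite S" "card S \<le> 2" "S \<subseteq> A" "A \<noteq> {}"
  obtains x y where "x \<in> A" "y \<in> A" "S \<subseteq> {x, y}"
proof -
  consider "card S = 0" | "card S = 1" | "card S = 2"
    using assms(2) by linarith
  thus thesis
  proof cases
    case 1
    thus thesis
      using assms that by auto
  next
    case 2
    then obtain x where "S = {x}"
      by (auto simp: card_1_singleton_iff)
    thus thesis
      using assms that[of x x] by auto
  next
    case 3
    then obtain x y where "S = {x, y}"
      by (auto simp: card_2_iff)
    thus thesis
      using assms that[of x y] by auto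
  qed
qed

section \<open>The cohomology algebra as an instance of \<open>short_algebra\<close>\<close>

theorem theorem1p2:
  fixes p m :: nat
    and G :: "('a, 'm) monoid_scheme" and T :: "'a topology"
    and F :: "('f, 'n) monoid_scheme" and TF :: "'f topology" and R :: "'f set"
  defines "K \<equiv> residue_ring (int p)"
  defines "H \<equiv> cohomology_algebra K G T"
  assumes "prime p"
    and "pro_p_group p G T"
    and "topologically_finitely_generated G T"
    and "minimal_presentation p F TF R G T"
    and "minimal_number_of_normal_generators F TF R m" and "m \<le> 2"
    and "quadratic_algebra K H"
    and "p = 2 \<Longrightarrow> (\<forall>a\<in>component H 1. a \<otimes>\<^bsub>H\<^esub> a = \<zero>\<^bsub>H\<^esub>)"
  shows "universally_koszul K H"
proof -
  interpret K: residues_prime p K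
    by (rule residues_prime.intro[OF assms(3)]) (simp add: K_def)
  obtain X \<pi> where pres: "free_pro_p p F TF X" "R \<lhd> F" "closedin TF R" "quotient_map TF T \<pi>" "\<pi> \<in> hom F G"
    "\<forall>f\<in>carrier F. \<forall>g\<in>carrier F. \<pi> f = \<pi> g \<longleftrightarrow> R #>\<^bsub>F\<^esub> f = R #>\<^bsub>F\<^esub> g"
    using assms(6) by (rule minimal_presentationE)
  have "card (carrier K) = p"
    by (simp add: K_def residue_ring_def)
  \<comment> \<open>The residues are integers, so the scalar type is countable.\<close>
  then interpret presented_group K p G T F TF R X \<pi>
    using assms(3,4) pres K.field_axioms
    by (intro presented_group.intro countable_field.intro presented_group_axioms.intro) simp_all
  have graded: "graded_algebra K H"
    using assms(9) by (simp add: quadratic_algebra_def)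
  hence ring: "ring H" and module: "Module.module K H"
    by (simp_all add: graded_algebra_def)
  have gen: "component H (Suc n) \<subseteq> component H 1 \<cdot>\<^bsub>H\<^esub> component H n" for n
    using assms(9) by (rule quadratic_algebra_generated)
  have gen2: "component H 2 \<subseteq> component H 1 \<cdot>\<^bsub>H\<^esub> component H 1"
    using gen[of 1] by (simp add: numeral_2_eq_2)
  obtain S where S: "S \<subseteq> R" "finite S" "card S = m" "closed_normal_closure F TF S = R"
    using assms(7) unfolding minimal_number_of_normal_generators_def by blast
  obtain r1 r2 where r: "r1 \<in> R" "r2 \<in> R" "S \<subseteq> {r1, r2}"
    using subset_pair[of S R] S assms(8) R.one_closed by blast
  interpret short_algebra K H
  proof
    show "graded_algebra K H"
      by (rule graded)
    show "component H (Suc n) \<subseteq> component H 1 \<cdot>\<^bsub>H\<^esub> component H n" for n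
      by (rule gen)
    show "a \<otimes>\<^bsub>H\<^esub> a = \<zero>\<^bsub>H\<^esub>" if "a \<in> component H 1" for a
    proof (cases "p = 2")
      case True
      thus ?thesis
        using assms(10) that by blast
    next
      case False
      hence "p > 2"
        using prime_ge_2_nat[OF assms(3)] by simp
      \<comment> \<open>For \<open>p > 2\<close> this sum is the residue 2 itself, so halving is
        possible in \<open>class_square_zero\<close>.\<close>
      hence "\<one>\<^bsub>K\<^esub> \<oplus>\<^bsub>K\<^esub> \<one>\<^bsub>K\<^esub> \<noteq> \<zero>\<^bsub>K\<^esub>"
        by (simp add: K_def residue_ring_def)
      with ring that show ?thesis
        unfolding H_def by (rule class_square_zero)
    qed
    show "\<exists>\<alpha>\<in>carrier K. \<exists>\<beta>\<in>carrier K. \<exists>\<gamma>\<in>carrier K. (\<alpha> \<noteq> \<zero>\<^bsub>K\<^esub> \<or> \<beta> \<noteq> \<zero>\<^bsub>K\<^esub> \<or> \<gamma> \<noteq> \<zero>\<^bsub>K\<^esub>) \<and>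
        \<alpha> \<odot>\<^bsub>H\<^esub> x \<oplus>\<^bsub>H\<^esub> \<beta> \<odot>\<^bsub>H\<^esub> y \<oplus>\<^bsub>H\<^esub> \<gamma> \<odot>\<^bsub>H\<^esub> z = \<zero>\<^bsub>H\<^esub>"
      if "x \<in> component H 2" "y \<in> component H 2" "z \<in> component H 2" for x y z
      using ring module gen2 S(1,4) r(3,1,2) that unfolding H_def by (rule degree_2_dependent)
  qed
  show ?thesis
    using assms(9) by (rule universally_koszulI)
qed

end
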